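(* Let $X, d$ be a continuous Yoneda-complete quasi-metric space. The $d_{\mathcal Q}$-Scott topology, the $d_{\mathcal Q}^a$-Scott topology, for every $a \in \mathbb{R}_+$, $a > 0$, and the upper Vietoris topology all coincide on $\mathcal Q X$.
   Context: A quasi-metric on $X$ is a map $d \colon X \times X \to [0,+\infty]$ with $d(x,x)=0$, the triangle inequality, and $d(x,y)=d(y,x)=0 \Rightarrow x=y$. Formal balls are pairs $(x,r)$, $x\in X$, $r\in \mathbb{R}_+=[0,+\infty)$, ordered by $(x,r) \leq^{d^+} (y,s)$ iff $d(x,y) \leq r-s$; they form the poset $\mathbf{B}(X,d)$, with its Scott topology. For any quasi-metric space $X,d$, the $d$-Scott topology on $X$ is the coarsest one making $x \mapsto (x,0) \in \mathbf{B}(X,d)$ continuous; quasi-metric spaces are given that topology. $X,d$ is continuous Yoneda-complete iff $\mathbf{B}(X,d)$ is a continuous dcpo. Compactness does not include any separation axiom; saturated means upwards-closed in the specialization ordering ($x\leq y$ iff $d(x,y)=0$). $\mathcal{Q} X$ is the set of non-empty compact saturated subsets of $X$. $d_{\mathcal Q}(Q,Q') = \sup_{h} \mathsf{d}_{\mathbb R}(\min_{x\in Q} h(x), \min_{x\in Q'} h(x))$, where $h$ ranges over the $1$-Lipschitz continuous maps from $X,d$ to $[0,+\infty],\mathsf{d}_{\mathbb R}$ (those such that $(x,r)\mapsto(h(x),r)$ is Scott-continuous from $\mathbf{B}(X,d)$ to $\mathbf{B}([0,+\infty],\mathsf{d}_{\mathbb R})$), and $\mathsf{d}_{\mathbb R}(x,y)=0$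 if $x \leq y$, $+\infty$ if $x=+\infty\neq y$, $x-y$ if $+\infty>x>y$. $d_{\mathcal Q}^a$ is defined by the same formula with $h$ further required to be bounded above by $a$. On Yoneda-complete spaces, $d_{\mathcal Q}(Q,Q') = \sup_{x' \in Q'} \inf_{x\in Q} d(x,x')$ and $d_{\mathcal Q}^a = \min(a,d_{\mathcal Q})$. The upper Vietoris topology on $\mathcal{Q}X$ has basic open sets $\{Q \in \mathcal{Q} X \mid Q \subseteq U\}$, $U$ open in $X$. *)

theory Defs
  imports "HOL-Analysis.Analysis" "HOL-Algebra.Order"
begin

section \<open>Continuous dcpos and the Scott topology\<close>

definition directed_in :: "('b, 'm) gorder_scheme \<Rightarrow> 'b set \<Rightarrow> bool" where
  "directed_in L D \<longleftrightarrow>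
     D \<subseteq> carrier L \<and> D \<noteq> {} \<and> (\<forall>x\<in>D. \<forall>y\<in>D. \<exists>z\<in>D. x \<sqsubseteq>\<^bsub>L\<^esub> z \<and> y \<sqsubseteq>\<^bsub>L\<^esub> z)"

abbreviation is_sup :: "('b, 'm) gorder_scheme \<Rightarrow> 'b set \<Rightarrow> 'b \<Rightarrow> bool" where
  "is_sup L D s \<equiv> least L s (Upper L D)"

definition way_below :: "('b, 'm) gorder_scheme \<Rightarrow> 'b \<Rightarrow> 'b \<Rightarrow> bool" where
  "way_below L x y \<longleftrightarrow>
     (\<forall>D s. directed_in L D \<and> is_sup L D s \<and> y \<sqsubseteq>\<^bsub>L\<^esub> s \<longrightarrow> (\<exists>z\<in>D. x \<sqsubseteq>\<^bsub>L\<^esub> z))"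

definition dcpo :: "('b, 'm) gorder_scheme \<Rightarrow> bool" where
  "dcpo L \<longleftrightarrow> partial_order L \<and> (\<forall>D. directed_in L D \<longrightarrow> (\<exists>s. is_sup L D s))"

definition continuous_dcpo :: "('b, 'm) gorder_scheme \<Rightarrow> bool" where
  "continuous_dcpo L \<longleftrightarrow>
     dcpo L \<and>
     (\<forall>y\<in>carrier L. \<exists>D. directed_in L D \<and> (\<forall>x\<in>D. way_below L x y) \<and> is_sup L D y)"

definition scott_open :: "('b, 'm) gorder_scheme \<Rightarrow> 'b set \<Rightarrow> bool" where
  "scott_open L U \<longleftrightarrow>
     U \<subseteq> carrier L \<and>
     (\<forall>x\<in>U. \<forall>y\<in>carrier L. x \<sqsubseteq>\<^bsub>L\<^esub> y \<longrightarrow> y \<in> U) \<and>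
     (\<forall>D s. directed_in L D \<and> is_sup L D s \<and> s \<in> U \<longrightarrow> D \<inter> U \<noteq> {})"

definition scott_topology :: "('b, 'm) gorder_scheme \<Rightarrow> 'b topology" where
  "scott_topology L = topology (scott_open L)"

lemma scott_openI:
  assumes "U \<subseteq> carrier L"
    and "\<And>x y. x \<in> U \<Longrightarrow> y \<in> carrier L \<Longrightarrow> x \<sqsubseteq>\<^bsub>L\<^esub> y \<Longrightarrow> y \<in> U"
    and "\<And>D s. directed_in L D \<Longrightarrow> is_sup L D s \<Longrightarrow> s \<in> U \<Longrightarrow> \<exists>x\<in>D. x \<in> U"
  shows "scott_open L U"
  unfolding scott_open_def
proof (intro conjI ballI allI impI)
  show "D \<inter> U \<noteq> {}" if "directed_in L D \<and> is_sup L D s \<and> s \<in> U" for D s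
    using assms(3)[of D s] that by auto
qed (use assms(1,2) in auto)

lemma scott_open_subset: "scott_open L U \<Longrightarrow> U \<subseteq> carrier L"
  unfolding scott_open_def by (elim conjE)

lemma scott_open_upward:
  "scott_open L U \<Longrightarrow> x \<in> U \<Longrightarrow> y \<in> carrier L \<Longrightarrow> x \<sqsubseteq>\<^bsub>L\<^esub> y \<Longrightarrow> y \<in> U"
  unfolding scott_open_def by (elim conjE) (drule (1) bspec, drule (1) bspec, erule (1) mp)

lemma scott_open_sup:
  assumes "scott_open L U" "directed_in L D" "is_sup L D s" "s \<in> U"
  obtains x where "x \<in> D" "x \<in> U"
proof -
  have "D \<inter> U \<noteq> {}"
    using assms unfolding scott_open_def
    by (elim conjE) (drule spec, drule spec, erule mp, intro conjI)
  then show ?thesis using that by auto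
qed

lemma istopology_scott_open: "istopology (scott_open L)"
  unfolding istopology_def
proof (intro conjI allI impI)
  fix U V assume U: "scott_open L U" and V: "scott_open L V"
  show "scott_open L (U \<inter> V)"
  proof (rule scott_openI)
    show "U \<inter> V \<subseteq> carrier L"
      using scott_open_subset[OF U] by auto
    show "y \<in> U \<inter> V" if "x \<in> U \<inter> V" "y \<in> carrier L" "x \<sqsubseteq>\<^bsub>L\<^esub> y" for x y
      using scott_open_upward[OF U _ that(2,3)] scott_open_upward[OF V _ that(2,3)] that(1) by auto
    fix D s assume D: "directed_in L D" "is_sup L D s" "s \<in> U \<inter> V"
    obtain x where x: "x \<in> D" "x \<in> U"
      using scott_open_sup[OF U D(1,2)] D(3) by auto
    obtain y where y: "y \<in> D" "y \<in> V"
      using scott_open_sup[OF V D(1,2)] D(3) by auto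
    obtain z where z: "z \<in> D" "x \<sqsubseteq>\<^bsub>L\<^esub> z" "y \<sqsubseteq>\<^bsub>L\<^esub> z"
      using D(1) x(1) y(1) unfolding directed_in_def by meson
    have "z \<in> carrier L"
      using D(1) z(1) unfolding directed_in_def by auto
    then show "\<exists>x\<in>D. x \<in> U \<inter> V"
      using scott_open_upward[OF U x(2) _ z(2)] scott_open_upward[OF V y(2) _ z(3)] z(1) by auto
  qed
next
  fix \<K> assume K: "\<forall>K\<in>\<K>. scott_open L K"
  show "scott_open L (\<Union>\<K>)"
  proof (rule scott_openI)
    show "\<Union>\<K> \<subseteq> carrier L"
      by (intro Union_least scott_open_subset K[rule_format])
    show "y \<in> \<Union>\<K>" if xy: "x \<in> \<Union>\<K>" "y \<in> carrier L" "x \<sqsubseteq>\<^bsub>L\<^esub> y" for x y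
    proof -
      obtain V where V: "V \<in> \<K>" "x \<in> V" using xy(1) by auto
      then show ?thesis
        using scott_open_upward[OF K[rule_format, OF V(1)] V(2) xy(2,3)] by auto
    qed
    fix D s assume D: "directed_in L D" "is_sup L D s" "s \<in> \<Union>\<K>"
    obtain V where V: "V \<in> \<K>" "s \<in> V" using D(3) by auto
    obtain x where "x \<in> D" "x \<in> V"
      using scott_open_sup[OF _ D(1,2) V(2)] K V(1) by auto
    then show "\<exists>x\<in>D. x \<in> \<Union>\<K>" using V(1) by auto
  qed
qed

lemma openin_scott_topology: "openin (scott_topology L) U \<longleftrightarrow> scott_open L U"
  unfolding scott_topology_def by (simp add: topology_inverse' istopology_scott_open)


section \<open>Quasi-metric spaces and formal balls\<close>

definition quasi_metric_space :: "'a set \<Rightarrow> ('a \<Rightarrow> 'a \<Rightarrow> ennreal) \<Rightarrow> bool" where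
  "quasi_metric_space X d \<longleftrightarrow>
     (\<forall>x\<in>X. d x x = 0) \<and>
     (\<forall>x\<in>X. \<forall>y\<in>X. \<forall>z\<in>X. d x z \<le> d x y + d y z) \<and>
     (\<forall>x\<in>X. \<forall>y\<in>X. d x y = 0 \<and> d y x = 0 \<longrightarrow> x = y)"

text \<open>The comparison of \<open>d x y\<close> with the possibly negative number \<open>r - s\<close> is made in
  \<^typ>\<open>ereal\<close>, since \<^const>\<open>ennreal\<close> truncates negative reals to 0.\<close>

definition formal_balls :: "'a set \<Rightarrow> ('a \<Rightarrow> 'a \<Rightarrow> ennreal) \<Rightarrow> ('a \<times> real) gorder" where
  "formal_balls X d =
     \<lparr> carrier = X \<times> {0..}, eq = (=),
       le = (\<lambda>(x, r) (y, s). enn2ereal (d x y) \<le> ereal (r - s)) \<rparr>"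

definition d_scott_topology :: "'a set \<Rightarrow> ('a \<Rightarrow> 'a \<Rightarrow> ennreal) \<Rightarrow> 'a topology" where
  "d_scott_topology X d =
     pullback_topology X (\<lambda>x. (x, 0)) (scott_topology (formal_balls X d))"

definition continuous_Yoneda_complete :: "'a set \<Rightarrow> ('a \<Rightarrow> 'a \<Rightarrow> ennreal) \<Rightarrow> bool" where
  "continuous_Yoneda_complete X d \<longleftrightarrow> continuous_dcpo (formal_balls X d)"

definition d_R :: "ennreal \<Rightarrow> ennreal \<Rightarrow> ennreal" where
  "d_R x y = (if x \<le> y then 0 else if x = \<infinity> then \<infinity> else x - y)"

definition lipschitz1_continuous ::
    "'a set \<Rightarrow> ('a \<Rightarrow> 'a \<Rightarrow> ennreal) \<Rightarrow> ('a \<Rightarrow> ennreal) \<Rightarrow> bool" where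
  "lipschitz1_continuous X d h \<longleftrightarrow>
     continuous_map (scott_topology (formal_balls X d))
                    (scott_topology (formal_balls UNIV d_R))
                    (\<lambda>(x, r). (h x, r))"


section \<open>The Smyth powerdomain\<close>

definition smyth :: "'a set \<Rightarrow> ('a \<Rightarrow> 'a \<Rightarrow> ennreal) \<Rightarrow> 'a set set" where
  "smyth X d =
     {Q. Q \<noteq> {} \<and> compactin (d_scott_topology X d) Q \<and>
         (\<forall>x\<in>Q. \<forall>y\<in>X. d x y = 0 \<longrightarrow> y \<in> Q)}"

text \<open>On a non-empty compact set, a 1-Lipschitz continuous map is lower semicontinuous and
  therefore attains its infimum, so the infima below are the minima of the usual definition.\<close>

definition d_Q :: "'a set \<Rightarrow> ('a \<Rightarrow> 'a \<Rightarrow> ennreal) \<Rightarrow> 'a set \<Rightarrow> 'a set \<Rightarrow> ennreal" where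
  "d_Q X d Q Q' =
     (SUP h \<in> {h. lipschitz1_continuous X d h}. d_R (INF x\<in>Q. h x) (INF x\<in>Q'. h x))"

definition d_Q_bounded ::
    "real \<Rightarrow> 'a set \<Rightarrow> ('a \<Rightarrow> 'a \<Rightarrow> ennreal) \<Rightarrow> 'a set \<Rightarrow> 'a set \<Rightarrow> ennreal" where
  "d_Q_bounded a X d Q Q' =
     (SUP h \<in> {h. lipschitz1_continuous X d h \<and> (\<forall>x\<in>X. h x \<le> ennreal a)}.
        d_R (INF x\<in>Q. h x) (INF x\<in>Q'. h x))"

definition upper_Vietoris_topology ::
    "'a set \<Rightarrow> ('a \<Rightarrow> 'a \<Rightarrow> ennreal) \<Rightarrow> 'a set topology" where
  "upper_Vietoris_topology X d =
     topology_generated_by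
       {{Q \<in> smyth X d. Q \<subseteq> U} | U. openin (d_scott_topology X d) U}"

end

theory Submission
  imports Defs
begin

text \<open>On the Smyth powerdomain, \<open>d_Q Q Q' \<le> t\<close> means that every point of \<open>Q'\<close> is at distance at most
  \<open>t\<close> from some point of \<open>Q\<close>; a bound \<open>a\<close> on the test functions only makes the condition void when
  \<open>a \<le> t\<close>, so both distances are treated at once with \<open>a \<in> (0, \<infinity>]\<close>. In one direction, \<open>(Q, 0)\<close> is
  the directed supremum of the balls \<open>(\<up>E, \<epsilon>)\<close> with \<open>E\<close> finite and every \<open>(x, 0)\<close>, \<open>x \<in> Q\<close>, way
  above some \<open>(y, \<epsilon>)\<close>, \<open>y \<in> E\<close>; being way above is an open condition. In the other direction, a
  directed family of balls \<open>(Q\<^sub>i, r\<^sub>i)\<close> yields a filtered family of compact sets \<open>Q\<^sub>i \<times> {r\<^sub>i}\<close> of formal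
  balls, and well-filteredness of the continuous dcpo of formal balls shows that any Scott-open
  set containing the limit contains some \<open>Q\<^sub>i \<times> {r\<^sub>i}\<close>.\<close>

text \<open>The ball order reads a distance only through real thresholds
  \<open>\<le> ennreal t\<close>, so no closed formula for the distances on compact sets is ever
  computed. Suprema of balls of compact sets are not computed in general either. For a directed
  family one constructs only an upper bound \<open>(Q1, \<rho>)\<close> that the family
  approximates; a supremum handed in by the definition of Scott-openness lies below that bound, and
  this comparison suffices. The delicate point is the radius. The limit in the poset of formal balls
  has to have radius exactly \<rho>, the infimum of the radii, and open sets known at radius 0 have
  to be moved to radius \<rho>. Both rest on the fact that suprema of balls commute with translation
  of radii, including the case where a translated radius would be negative.\<close>

section \<open>Compactness along chains of open sets\<close>

text \<open>A finite non-empty subfamily of a chain contains its own union, so a finite subcover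
  collapses to one member.\<close>

lemma compactin_chain_cover:
  assumes "compactin T K" and "subset.chain \<A> \<U>" and "\<U> \<noteq> {}"
    and "\<And>U. U \<in> \<U> \<Longrightarrow> openin T U" and "K \<subseteq> \<Union>\<U>"
  shows "\<exists>U\<in>\<U>. K \<subseteq> U"
proof -
  obtain \<F> where F: "finite \<F>" "\<F> \<subseteq> \<U>" "K \<subseteq> \<Union>\<F>"
    using compactinD[OF assms(1,4,5)] by blast
  show ?thesis
  proof (cases "\<F> = {}")
    case True
    then show ?thesis using F(3) assms(3) by auto
  next
    case False
    have "subset.chain \<A> \<F>" using assms(2) F(2) unfolding subset_chain_def by (meson subset_trans subset_iff)
    then have "\<Union>\<F> \<in> \<U>" using Union_in_chain[OF F(1) False] F(2) by (meson subsetD)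
    then show ?thesis using F(3) by (rule bexI[rotated])
  qed
qed

text \<open>Used to turn a positive slack that depends on the point into one slack
  \<open>inverse (real (Suc n))\<close> valid on a whole compact set.\<close>

lemma compactin_incseq_cover:
  fixes U :: "nat \<Rightarrow> 'b set"
  assumes "compactin T K" and "\<And>n. openin T (U n)" and "incseq U" and "K \<subseteq> (\<Union>n. U n)"
  shows "\<exists>n. K \<subseteq> U n"
proof -
  have "subset.chain UNIV (range U)"
    unfolding subset_chain_def
  proof (intro conjI ballI)
    fix x y assume "x \<in> range U" "y \<in> range U"
    then obtain m n where "x = U m" "y = U n" by blast
    then show "x \<subseteq> y \<or> y \<subseteq> x"
      using incseqD[OF assms(3), of m n] incseqD[OF assms(3), of n m] linear[of m n] by blast
  qed simp
  then show ?thesis using compactin_chain_cover[OF assms(1), of UNIV "range U"] assms(2,4) by auto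
qed


section \<open>Continuous dcpos\<close>

lemma is_sup_carrier: "is_sup L D s \<Longrightarrow> s \<in> carrier L"
  by (auto simp: least_def Upper_def)

lemma is_sup_upper: "is_sup L D s \<Longrightarrow> x \<in> D \<Longrightarrow> x \<in> carrier L \<Longrightarrow> x \<sqsubseteq>\<^bsub>L\<^esub> s"
  by (auto simp: least_def Upper_def)

lemma is_sup_least:
  "is_sup L D s \<Longrightarrow> u \<in> carrier L \<Longrightarrow> (\<And>x. x \<in> D \<Longrightarrow> x \<in> carrier L \<Longrightarrow> x \<sqsubseteq>\<^bsub>L\<^esub> u) \<Longrightarrow> s \<sqsubseteq>\<^bsub>L\<^esub> u"
  by (auto simp: least_def Upper_def)

lemma is_supI:
  assumes "s \<in> carrier L" and "\<And>x. x \<in> D \<Longrightarrow> x \<in> carrier L \<Longrightarrow> x \<sqsubseteq>\<^bsub>L\<^esub> s"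
    and "\<And>u. u \<in> carrier L \<Longrightarrow> (\<And>x. x \<in> D \<Longrightarrow> x \<in> carrier L \<Longrightarrow> x \<sqsubseteq>\<^bsub>L\<^esub> u) \<Longrightarrow> s \<sqsubseteq>\<^bsub>L\<^esub> u"
  shows "is_sup L D s"
  using assms by (auto simp: least_def Upper_def)

lemma directed_inI:
  assumes "D \<subseteq> carrier L" "D \<noteq> {}"
    and "\<And>x y. x \<in> D \<Longrightarrow> y \<in> D \<Longrightarrow> \<exists>z\<in>D. x \<sqsubseteq>\<^bsub>L\<^esub> z \<and> y \<sqsubseteq>\<^bsub>L\<^esub> z"
  shows "directed_in L D"
  unfolding directed_in_def using assms by blast

lemma directed_in_subset: "directed_in L D \<Longrightarrow> D \<subseteq> carrier L"
  by (simp add: directed_in_def)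

lemma directed_in_nonempty: "directed_in L D \<Longrightarrow> D \<noteq> {}"
  by (simp add: directed_in_def)

lemma directed_inD:
  "directed_in L D \<Longrightarrow> x \<in> D \<Longrightarrow> y \<in> D \<Longrightarrow> \<exists>z\<in>D. x \<sqsubseteq>\<^bsub>L\<^esub> z \<and> y \<sqsubseteq>\<^bsub>L\<^esub> z"
  by (simp add: directed_in_def)

lemma topspace_scott_topology [simp]: "topspace (scott_topology L) = carrier L"
proof (rule antisym)
  show "topspace (scott_topology L) \<subseteq> carrier L"
    using openin_topspace[of "scott_topology L"] scott_open_subset
    unfolding openin_scott_topology by blast
  have "scott_open L (carrier L)"
    by (rule scott_openI) (auto simp: directed_in_def)
  then show "carrier L \<subseteq> topspace (scott_topology L)"
    by (simp add: openin_subset openin_scott_topology)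
qed

lemma scott_open_carrier: "scott_open L (carrier L)"
  using openin_topspace[of "scott_topology L"] by (simp add: openin_scott_topology)

lemma scott_open_Int: "scott_open L U \<Longrightarrow> scott_open L V \<Longrightarrow> scott_open L (U \<inter> V)"
  using openin_Int[of "scott_topology L" U V] by (simp add: openin_scott_topology)

lemma scott_open_Union: "(\<And>U. U \<in> \<U> \<Longrightarrow> scott_open L U) \<Longrightarrow> scott_open L (\<Union>\<U>)"
  using openin_Union[of \<U> "scott_topology L"] by (simp add: openin_scott_topology)

text \<open>If no member of \<open>D\<close> escaped the down-set of \<open>z\<close>, then
  \<open>z\<close> would bound \<open>D\<close> and hence its supremum. Transitivity is an explicit
  premise because the lemma also serves the balls over \<open>d_R\<close>, for which no order locale
  is interpreted.\<close>

lemma scott_open_not_below: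
  assumes trans: "\<And>x y. x \<in> carrier L \<Longrightarrow> y \<in> carrier L \<Longrightarrow> x \<sqsubseteq>\<^bsub>L\<^esub> y \<Longrightarrow> y \<sqsubseteq>\<^bsub>L\<^esub> z \<Longrightarrow> x \<sqsubseteq>\<^bsub>L\<^esub> z"
    and "z \<in> carrier L"
  shows "scott_open L {x \<in> carrier L. \<not> x \<sqsubseteq>\<^bsub>L\<^esub> z}"
proof (rule scott_openI)
  fix D s assume D: "directed_in L D" "is_sup L D s" "s \<in> {x \<in> carrier L. \<not> x \<sqsubseteq>\<^bsub>L\<^esub> z}"
  then show "\<exists>x\<in>D. x \<in> {x \<in> carrier L. \<not> x \<sqsubseteq>\<^bsub>L\<^esub> z}"
    using is_sup_least[OF D(2) assms(2)] directed_in_subset[OF D(1)] by auto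
qed (use trans in auto)

locale cont_dcpo =
  fixes L :: "('b, 'm) gorder_scheme" (structure)
  assumes cont: "continuous_dcpo L"
begin

sublocale partial_order L
  using cont by (simp add: continuous_dcpo_def dcpo_def)

lemma sup_exists: "directed_in L D \<Longrightarrow> \<exists>s. is_sup L D s"
  using cont by (simp add: continuous_dcpo_def dcpo_def)

lemma approximants:
  assumes "y \<in> carrier L"
  obtains D where "directed_in L D" "\<And>x. x \<in> D \<Longrightarrow> way_below L x y" "is_sup L D y"
  using cont assms unfolding continuous_dcpo_def by blast

lemma way_below_le: "way_below L x y \<Longrightarrow> y \<in> carrier L \<Longrightarrow> x \<sqsubseteq> y"
proof -
  assume *: "way_below L x y" "y \<in> carrier L"
  have "directed_in L {y}" "is_sup L {y} y"
    using *(2) by (auto intro!: directed_inI is_supI)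
  then show ?thesis using * unfolding way_below_def by blast
qed

lemma way_below_le_trans:
  assumes "way_below L x y" "y \<sqsubseteq> z" "y \<in> carrier L" "z \<in> carrier L"
  shows "way_below L x z"
  unfolding way_below_def
proof (intro allI impI; elim conjE)
  fix D s assume D: "directed_in L D" "is_sup L D s" "z \<sqsubseteq> s"
  then have "y \<sqsubseteq> s" using le_trans assms is_sup_carrier by metis
  then show "\<exists>z\<in>D. x \<sqsubseteq> z" using assms(1) D unfolding way_below_def by blast
qed

lemma le_way_below_trans:
  assumes "x \<sqsubseteq> y" "way_below L y z" "x \<in> carrier L" "y \<in> carrier L"
  shows "way_below L x z"
  unfolding way_below_def
proof (intro allI impI; elim conjE)
  fix D s assume D: "directed_in L D" "is_sup L D s" "z \<sqsubseteq> s"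
  then obtain w where "w \<in> D" "y \<sqsubseteq> w" using assms(2) unfolding way_below_def by blast
  then show "\<exists>z\<in>D. x \<sqsubseteq> z" using directed_in_subset[OF D(1)] le_trans assms by blast
qed

lemma way_below_directed:
  assumes "way_below L x z" "way_below L y z" "z \<in> carrier L" "x \<in> carrier L" "y \<in> carrier L"
  shows "\<exists>w\<in>carrier L. x \<sqsubseteq> w \<and> y \<sqsubseteq> w \<and> way_below L w z"
proof -
  obtain D where D: "directed_in L D" "\<And>x. x \<in> D \<Longrightarrow> way_below L x z" "is_sup L D z"
    using approximants[OF assms(3)] by blast
  obtain x' y' where "x' \<in> D" "x \<sqsubseteq> x'" "y' \<in> D" "y \<sqsubseteq> y'"
    using D assms unfolding way_below_def by (meson le_refl)
  moreover then obtain w where "w \<in> D" "x' \<sqsubseteq> w" "y' \<sqsubseteq> w"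
    using directed_inD[OF D(1)] by blast
  ultimately show ?thesis
    using D(2) directed_in_subset[OF D(1)] le_trans assms by (meson subsetD)
qed

text \<open>The points two way-below steps under \<open>y\<close> form a directed set with supremum
  \<open>y\<close>. Since \<open>x\<close> is way below \<open>y\<close>, one of them dominates
  \<open>x\<close>, and its intermediate point interpolates.\<close>

lemma way_below_interpolation:
  assumes "way_below L x y" "y \<in> carrier L" "x \<in> carrier L"
  shows "\<exists>z\<in>carrier L. way_below L x z \<and> way_below L z y"
proof -
  let ?D = "{w \<in> carrier L. \<exists>z\<in>carrier L. way_below L w z \<and> way_below L z y}"
  have ex: "\<exists>w\<in>carrier L. way_below L w z" if "z \<in> carrier L" for z
    using approximants[OF that] directed_in_nonempty directed_in_subset by (metis ex_in_conv subsetD)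
  have dir: "directed_in L ?D"
  proof (rule directed_inI)
    show "?D \<noteq> {}" using ex[OF assms(2)] ex by blast
    fix w1 w2 assume "w1 \<in> ?D" "w2 \<in> ?D"
    then obtain z1 z2 where z: "z1 \<in> carrier L" "z2 \<in> carrier L" "way_below L w1 z1" "way_below L w2 z2"
        "way_below L z1 y" "way_below L z2 y" and w: "w1 \<in> carrier L" "w2 \<in> carrier L" by blast
    then obtain z3 where z3: "z3 \<in> carrier L" "z1 \<sqsubseteq> z3" "z2 \<sqsubseteq> z3" "way_below L z3 y"
      using way_below_directed[of z1 y z2] assms(2) by blast
    then have "way_below L w1 z3" "way_below L w2 z3" using z way_below_le_trans by blast+
    then obtain w3 where "w3 \<in> carrier L" "w1 \<sqsubseteq> w3" "w2 \<sqsubseteq> w3" "way_below L w3 z3"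
      using way_below_directed[of w1 z3 w2] z3 w by blast
    then show "\<exists>z\<in>?D. w1 \<sqsubseteq> z \<and> w2 \<sqsubseteq> z" using z3 by blast
  qed auto
  have "is_sup L ?D y"
  proof (rule is_supI)
    show "w \<sqsubseteq> y" if w: "w \<in> ?D" for w
    proof -
      obtain z where z: "z \<in> carrier L" "way_below L w z" "way_below L z y" "w \<in> carrier L"
        using w by blast
      then show ?thesis
        using way_below_le[OF z(2,1)] way_below_le[OF z(3) assms(2)] le_trans assms(2) by meson
    qed
    fix u assume u: "u \<in> carrier L" "\<And>w. w \<in> ?D \<Longrightarrow> w \<in> carrier L \<Longrightarrow> w \<sqsubseteq> u"
    have "z \<sqsubseteq> u" if z: "z \<in> carrier L" "way_below L z y" for z
    proof -
      obtain E where E: "directed_in L E" "\<And>w. w \<in> E \<Longrightarrow> way_below L w z" "is_sup L E z"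
        using approximants[OF z(1)] by blast
      then show ?thesis using is_sup_least[OF E(3) u(1)] u(2) z by blast
    qed
    moreover obtain E where "directed_in L E" "\<And>w. w \<in> E \<Longrightarrow> way_below L w y" "is_sup L E y"
      using approximants[OF assms(2)] by blast
    ultimately show "y \<sqsubseteq> u" using is_sup_least u(1) by metis
  qed (rule assms(2))
  then obtain w where "w \<in> ?D" "x \<sqsubseteq> w"
    using assms dir unfolding way_below_def[of L x y] using le_refl by blast
  then show ?thesis using le_way_below_trans assms by blast
qed

text \<open>Interpolation is the point: from \<open>x\<close> way below \<open>z\<close> way below
  \<open>s\<close>, a member of \<open>D\<close> above \<open>z\<close> is still way above
  \<open>x\<close>.\<close>

lemma scott_open_way_above:
  assumes "x \<in> carrier L"
  shows "scott_open L {y \<in> carrier L. way_below L x y}"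
proof (rule scott_openI)
  fix D s assume D: "directed_in L D" "is_sup L D s" "s \<in> {y \<in> carrier L. way_below L x y}"
  then obtain z where z: "z \<in> carrier L" "way_below L x z" "way_below L z s"
    using way_below_interpolation assms by blast
  then obtain w where "w \<in> D" "z \<sqsubseteq> w"
    using D unfolding way_below_def[of L z s] using le_refl by blast
  then show "\<exists>y\<in>D. y \<in> {y \<in> carrier L. way_below L x y}"
    using z way_below_le_trans directed_in_subset[OF D(1)] by blast
qed (use way_below_le_trans in auto)

text \<open>A Rudin-type lemma. Shrink \<open>C\<close> to a minimal closed set still meeting every member of
  \<open>\<K>\<close>: minimality makes the elements way below a point of it directed, and their supremum is the
  required \<open>z\<close>.\<close>

lemma filtered_compact_meets_closed:
  assumes "\<K> \<noteq> {}" and compact: "\<And>K. K \<in> \<K> \<Longrightarrow> compactin (scott_topology L) K"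
    and filtered: "\<And>K1 K2. K1 \<in> \<K> \<Longrightarrow> K2 \<in> \<K> \<Longrightarrow>
      \<exists>K3\<in>\<K>. \<forall>y\<in>K3. (\<exists>x\<in>K1. x \<sqsubseteq> y) \<and> (\<exists>x\<in>K2. x \<sqsubseteq> y)"
    and closed: "closedin (scott_topology L) C"
    and meets: "\<And>K. K \<in> \<K> \<Longrightarrow> C \<inter> K \<noteq> {}"
  shows "\<exists>z\<in>C. \<forall>K\<in>\<K>. \<exists>y\<in>K. y \<sqsubseteq> z"
proof -
  let ?T = "scott_topology L"
  \<comment> \<open>Minimality of the closed set \<open>C - U\<close> is phrased as maximality of
    the open set \<open>U\<close>, so that Zorn's lemma runs on unions of chains; compactness of
    \<open>C \<inter> K\<close> keeps such a union in the family.\<close>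
  let ?A = "{U. openin ?T U \<and> (\<forall>K\<in>\<K>. \<not> C \<inter> K \<subseteq> U)}"
  have zorn: "\<exists>U\<in>?A. \<forall>V\<in>?A. U \<subseteq> V \<longrightarrow> V = U"
  proof (rule subset_Zorn')
    fix \<U> assume chain: "subset.chain ?A \<U>"
    then have op: "openin ?T U" if "U \<in> \<U>" for U
      using that unfolding subset_chain_def by blast
    have "\<not> C \<inter> K \<subseteq> \<Union>\<U>" if K: "K \<in> \<K>" for K
    proof
      assume sub: "C \<inter> K \<subseteq> \<Union>\<U>"
      then have "\<U> \<noteq> {}" using meets[OF K] by auto
      then obtain U where "U \<in> \<U>" "C \<inter> K \<subseteq> U"
        using compactin_chain_cover[OF closed_Int_compactin[OF closed compact[OF K]] chain _ op sub]
        by blast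
      then show False using chain K unfolding subset_chain_def by blast
    qed
    then show "\<Union>\<U> \<in> ?A" using op by auto
  qed
  obtain U where UA: "U \<in> ?A" and maxA: "\<forall>V\<in>?A. U \<subseteq> V \<longrightarrow> V = U"
    using zorn by (rule bexE)
  have U: "openin ?T U" "\<And>K. K \<in> \<K> \<Longrightarrow> \<not> C \<inter> K \<subseteq> U" using UA by simp_all
  have max: "V = U" if "openin ?T V" "U \<subseteq> V" "\<forall>K\<in>\<K>. \<not> C \<inter> K \<subseteq> V" for V
    using maxA that by simp
  define C' where "C' = C - U"
  have C'_closed: "closedin ?T C'" using closed U(1) by (auto simp: C'_def closedin_diff)
  then have C'_car: "C' \<subseteq> carrier L" using closedin_subset by fastforce
  have C'_open: "scott_open L (carrier L - C')"
    using C'_closed openin_scott_topology[of L "carrier L - C'"] by (simp add: closedin_def)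
  have C'_down: "x \<in> C'" if "x \<sqsubseteq> y" "y \<in> C'" "x \<in> carrier L" for x y
    using scott_open_upward[OF C'_open, of x y] that C'_car by blast
  \<comment> \<open>Adding to \<open>U\<close> the open set of points way above \<open>w\<close>
    enlarges it strictly, since it gains \<open>z\<close>. By maximality the result swallows some
    \<open>C \<inter> K\<close>.\<close>
  have near: "\<exists>K\<in>\<K>. C' \<inter> K \<subseteq> {y \<in> carrier L. way_below L w y}"
    if w: "w \<in> carrier L" "way_below L w z" "z \<in> C'" for w z
  proof -
    let ?W = "{y \<in> carrier L. way_below L w y}"
    have "openin ?T (U \<union> ?W)"
      using U(1) scott_open_way_above[OF w(1)] by (auto simp: openin_scott_topology[symmetric])
    moreover have "U \<union> ?W \<noteq> U" using w C'_car unfolding C'_def by blast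
    ultimately obtain K where "K \<in> \<K>" "C \<inter> K \<subseteq> U \<union> ?W" using max[of "U \<union> ?W"] by blast
    then show ?thesis unfolding C'_def by blast
  qed
  have meets': "C' \<inter> K \<noteq> {}" if "K \<in> \<K>" for K using U(2)[OF that] unfolding C'_def by blast
  let ?D = "{w \<in> carrier L. \<exists>z\<in>C'. way_below L w z}"
  have dir: "directed_in L ?D"
  proof (rule directed_inI)
    obtain K where "K \<in> \<K>" using assms(1) by blast
    then obtain y where "y \<in> C'" using meets' by blast
    then have "y \<in> carrier L" using C'_car by blast
    then obtain D where D: "directed_in L D" "\<And>x. x \<in> D \<Longrightarrow> way_below L x y"
      using approximants by blast
    then obtain x where "x \<in> D" "x \<in> carrier L"
      using directed_in_nonempty directed_in_subset by (metis ex_in_conv subsetD)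
    then show "?D \<noteq> {}" using D(2) \<open>y \<in> C'\<close> by blast
    fix w1 w2 assume w: "w1 \<in> ?D" "w2 \<in> ?D"
    then obtain K1 K2 where K: "K1 \<in> \<K>" "C' \<inter> K1 \<subseteq> {y \<in> carrier L. way_below L w1 y}"
        "K2 \<in> \<K>" "C' \<inter> K2 \<subseteq> {y \<in> carrier L. way_below L w2 y}"
      using near by blast
    obtain K3 where K3: "K3 \<in> \<K>" "\<forall>y\<in>K3. (\<exists>x\<in>K1. x \<sqsubseteq> y) \<and> (\<exists>x\<in>K2. x \<sqsubseteq> y)"
      using filtered[OF K(1,3)] by (rule bexE)
    obtain y where y: "y \<in> C'" "y \<in> K3" using meets'[OF K3(1)] by blast
    then obtain x1 x2 where x: "x1 \<in> K1" "x1 \<sqsubseteq> y" "x2 \<in> K2" "x2 \<sqsubseteq> y" using K3 by blast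
    have car: "x1 \<in> carrier L" "x2 \<in> carrier L" "y \<in> carrier L"
      using x compactin_subset_topspace[OF compact[OF K(1)]] compactin_subset_topspace[OF compact[OF K(3)]]
        y C'_car by auto
    \<comment> \<open>Because \<open>C'\<close> is a down-set, \<open>x1\<close> and
      \<open>x2\<close> lie in it, and \<open>near\<close> applies to them.\<close>
    have "way_below L w1 x1" "way_below L w2 x2" using C'_down[OF x(2) y(1) car(1)] C'_down[OF x(4) y(1) car(2)] x K by blast+
    then have "way_below L w1 y" "way_below L w2 y" using x car way_below_le_trans by blast+
    then show "\<exists>z\<in>?D. w1 \<sqsubseteq> z \<and> w2 \<sqsubseteq> z"
      using way_below_directed[of w1 y w2] w y car by blast
  qed auto
  then obtain z where z: "is_sup L ?D z" using sup_exists by blast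
  have "z \<in> C'"
  proof (rule ccontr)
    assume "z \<notin> C'"
    then have "z \<in> carrier L - C'" using is_sup_carrier[OF z] by blast
    then obtain w where "w \<in> ?D" "w \<in> carrier L - C'" using scott_open_sup[OF C'_open dir z] by blast
    then show False using C'_down way_below_le C'_car by blast
  qed
  \<comment> \<open>Any point of \<open>C' \<inter> K\<close> is the supremum of its approximants,
    all of which belong to \<open>?D\<close>, so it lies below \<open>z\<close>.\<close>
  moreover have "\<exists>y\<in>K. y \<sqsubseteq> z" if K: "K \<in> \<K>" for K
  proof -
    obtain y where y: "y \<in> C'" "y \<in> K" using meets'[OF K] by blast
    then have "y \<in> carrier L" using C'_car by blast
    then obtain D where D: "directed_in L D" "\<And>x. x \<in> D \<Longrightarrow> way_below L x y" "is_sup L D y"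
      using approximants by blast
    then have "D \<subseteq> ?D" using y directed_in_subset by blast
    then have "y \<sqsubseteq> z" using is_sup_least[OF D(3) is_sup_carrier[OF z]] is_sup_upper[OF z] by blast
    then show ?thesis using y by blast
  qed
  ultimately show ?thesis unfolding C'_def by blast
qed

end


section \<open>Formal balls\<close>

lemma carrier_formal_balls [simp]: "carrier (formal_balls X d) = X \<times> {0..}"
  by (simp add: formal_balls_def)

lemma enn2ereal_le_ereal_iff: "enn2ereal u \<le> ereal t \<longleftrightarrow> 0 \<le> t \<and> u \<le> ennreal t"
proof (cases "0 \<le> t")
  case True
  then show ?thesis by (simp add: less_eq_ennreal.rep_eq)
next
  case False
  have "0 \<le> enn2ereal u" by simp
  moreover have "ereal t < 0" using False by simp
  ultimately show ?thesis using False by (metis leD order_less_le_trans)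
qed

text \<open>Splitting off the sign condition \<open>s \<le> r\<close> removes \<open>ereal\<close>
  from all later arguments.\<close>

lemma le_formal_balls [simp]:
  "(x, r) \<sqsubseteq>\<^bsub>formal_balls X d\<^esub> (y, s) \<longleftrightarrow> s \<le> r \<and> d x y \<le> ennreal (r - s)"
  by (simp add: formal_balls_def enn2ereal_le_ereal_iff)

lemma ennreal_le_if_le_inverse:
  assumes "\<And>n. u \<le> ennreal (t + inverse (real (Suc n)))" "0 \<le> t"
  shows "u \<le> ennreal t"
proof (rule ennreal_le_epsilon)
  fix e :: real assume "0 < e"
  then obtain n where n: "inverse (real (Suc n)) < e" using reals_Archimedean by blast
  have "u \<le> ennreal t + ennreal (inverse (real (Suc n)))"
    using assms(1)[of n] assms(2) by (subst ennreal_plus[symmetric]) auto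
  also have "\<dots> \<le> ennreal t + ennreal e" using n by (intro add_left_mono ennreal_leI) simp
  finally show "u \<le> ennreal t + ennreal e" .
qed

lemma openin_d_scott_topology:
  "openin (d_scott_topology X d) U \<longleftrightarrow>
     (\<exists>V. scott_open (formal_balls X d) V \<and> U = {x \<in> X. (x, 0) \<in> V})"
  unfolding d_scott_topology_def openin_pullback_topology openin_scott_topology by auto

lemma topspace_d_scott_topology [simp]: "topspace (d_scott_topology X d) = X"
  unfolding d_scott_topology_def topspace_pullback_topology by auto

lemma smyth_subset: "Q \<in> smyth X d \<Longrightarrow> Q \<subseteq> X"
  unfolding smyth_def using compactin_subset_topspace by fastforce

lemma smyth_compact: "Q \<in> smyth X d \<Longrightarrow> compactin (d_scott_topology X d) Q"
  by (simp add: smyth_def)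

lemma smyth_nonempty: "Q \<in> smyth X d \<Longrightarrow> Q \<noteq> {}"
  by (simp add: smyth_def)

lemma smyth_saturated: "Q \<in> smyth X d \<Longrightarrow> x \<in> Q \<Longrightarrow> y \<in> X \<Longrightarrow> d x y = 0 \<Longrightarrow> y \<in> Q"
  by (auto simp: smyth_def)

section \<open>Translation of radii and standardness\<close>

definition shift :: "real \<Rightarrow> ('a \<times> real) set \<Rightarrow> ('a \<times> real) set" where
  "shift c D = (\<lambda>(x, r). (x, r + c)) ` D"

lemma shift_iff: "(x, r) \<in> shift c D \<longleftrightarrow> (x, r - c) \<in> D"
  unfolding shift_def by force

lemma shift_0 [simp]: "shift 0 D = D"
  unfolding shift_def by auto

lemma directed_shift:
  assumes "directed_in (formal_balls X d) D" and "\<And>x r. (x, r) \<in> D \<Longrightarrow> 0 \<le> r + c"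
  shows "directed_in (formal_balls X d) (shift c D)"
proof (rule directed_inI)
  show "shift c D \<subseteq> carrier (formal_balls X d)"
    using assms(2) directed_in_subset[OF assms(1)] unfolding shift_def by auto
  show "shift c D \<noteq> {}"
    using directed_in_nonempty[OF assms(1)] unfolding shift_def by auto
  fix p q assume "p \<in> shift c D" "q \<in> shift c D"
  then obtain x r y s where pq: "p = (x, r + c)" "q = (y, s + c)" "(x, r) \<in> D" "(y, s) \<in> D"
    unfolding shift_def by auto
  obtain z t where "(z, t) \<in> D" "(x, r) \<sqsubseteq>\<^bsub>formal_balls X d\<^esub> (z, t)" "(y, s) \<sqsubseteq>\<^bsub>formal_balls X d\<^esub> (z, t)"
    using directed_inD[OF assms(1) pq(3,4)] by auto
  then show "\<exists>w\<in>shift c D. p \<sqsubseteq>\<^bsub>formal_balls X d\<^esub> w \<and> q \<sqsubseteq>\<^bsub>formal_balls X d\<^esub> w"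
    using pq by (intro bexI[of _ "(z, t + c)"]) (auto simp: shift_iff)
qed

locale yoneda_complete =
  fixes X :: "'a set" and d :: "'a \<Rightarrow> 'a \<Rightarrow> ennreal"
  assumes quasi_metric: "quasi_metric_space X d"
    and continuous_Yoneda: "continuous_Yoneda_complete X d"
begin

abbreviation B :: "('a \<times> real) gorder" where
  "B \<equiv> formal_balls X d"

sublocale B: cont_dcpo B
  using continuous_Yoneda by unfold_locales (simp add: continuous_Yoneda_complete_def)

lemma d_refl [simp]: "x \<in> X \<Longrightarrow> d x x = 0"
  using quasi_metric by (simp add: quasi_metric_space_def)

lemma d_triangle: "x \<in> X \<Longrightarrow> y \<in> X \<Longrightarrow> z \<in> X \<Longrightarrow> d x z \<le> d x y + d y z"
  using quasi_metric by (simp add: quasi_metric_space_def)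

lemma d_antisym: "x \<in> X \<Longrightarrow> y \<in> X \<Longrightarrow> d x y = 0 \<Longrightarrow> d y x = 0 \<Longrightarrow> x = y"
  using quasi_metric by (simp add: quasi_metric_space_def)

text \<open>Standardness. After shifting the infimum of the radii to 0, the supremum has radius 0;
  re-shifting by \<open>c\<close> can only move its centre to an equivalent point, hence to the same one.\<close>

lemma sup_radius_and_shift:
  assumes D: "directed_in B D" and sup: "is_sup B D (x, r)"
  shows "r = Inf (snd ` D)" and "0 \<le> r + c \<Longrightarrow> is_sup B (shift c D) (x, r + c)"
proof -
  define \<rho> where "\<rho> = Inf (snd ` D)"
  have ne: "snd ` D \<noteq> {}" using directed_in_nonempty[OF D] by auto
  have Dcar: "y \<in> X" "0 \<le> s" if "(y, s) \<in> D" for y s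
    using directed_in_subset[OF D] that by auto
  have lower: "\<rho> \<le> s" if "(y, s) \<in> D" for y s
    unfolding \<rho>_def using Dcar that by (intro cInf_lower bdd_belowI[of _ 0]) force+
  have greatest: "t \<le> \<rho>" if "\<And>y s. (y, s) \<in> D \<Longrightarrow> t \<le> s" for t
    unfolding \<rho>_def using that by (intro cInf_greatest ne) auto
  have dir: "directed_in B (shift (b - \<rho>) D)" if "0 \<le> b" for b
    using D by (rule directed_shift) (use lower that in \<open>force\<close>)
  have radius: "u \<le> b" if "0 \<le> b" "is_sup B (shift (b - \<rho>) D) (z, u)" for b z u
  proof -
    have "u - b + \<rho> \<le> s" if "(y, s) \<in> D" for y s
      using is_sup_upper[OF \<open>is_sup B (shift (b - \<rho>) D) (z, u)\<close>, of "(y, s + (b - \<rho>))"] that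
        Dcar[OF that] lower[OF that] \<open>0 \<le> b\<close>
      by (simp add: shift_iff)
    then have "u - b + \<rho> \<le> \<rho>" by (rule greatest)
    then show ?thesis by simp
  qed
  obtain x0 u0 where "is_sup B (shift (0 - \<rho>) D) (x0, u0)"
    using B.sup_exists[OF dir[of 0]] by auto
  moreover then have "u0 = 0" using radius[of 0] is_sup_carrier by fastforce
  ultimately have x0: "is_sup B (shift (0 - \<rho>) D) (x0, 0)" by simp
  then have x0X: "x0 \<in> X" using is_sup_carrier by fastforce
  have main: "is_sup B (shift (b - \<rho>) D) (x0, b)" if b: "0 \<le> b" for b
  proof -
    obtain z u where z: "is_sup B (shift (b - \<rho>) D) (z, u)"
      using B.sup_exists[OF dir[OF b]] by auto
    have zX: "z \<in> X" using is_sup_carrier[OF z] by simp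
    have "(z, u) \<sqsubseteq>\<^bsub>B\<^esub> (x0, b)"
    proof (rule is_sup_least[OF z])
      fix p assume "p \<in> shift (b - \<rho>) D" "p \<in> carrier B"
      moreover obtain y s where "p = (y, s)" by (cases p)
      ultimately have p: "(y, s - (b - \<rho>)) \<in> D" "p = (y, s)" by (auto simp: shift_iff)
      then have "(y, s - b) \<in> shift (0 - \<rho>) D" by (simp add: shift_iff algebra_simps)
      then show "p \<sqsubseteq>\<^bsub>B\<^esub> (x0, b)"
        using is_sup_upper[OF x0, of "(y, s - b)"] Dcar[OF p(1)] lower[OF p(1)] p(2) by simp
    qed (use x0X b in auto)
    then have u: "u = b" "d z x0 = 0" using radius[OF b z] by auto
    have "(x0, 0) \<sqsubseteq>\<^bsub>B\<^esub> (z, 0)"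
    proof (rule is_sup_least[OF x0])
      fix p assume "p \<in> shift (0 - \<rho>) D" "p \<in> carrier B"
      moreover obtain y s where "p = (y, s)" by (cases p)
      ultimately have p: "(y, s + \<rho>) \<in> D" "p = (y, s)" by (auto simp: shift_iff)
      then have "(y, s + b) \<in> shift (b - \<rho>) D" by (simp add: shift_iff algebra_simps)
      then show "p \<sqsubseteq>\<^bsub>B\<^esub> (z, 0)"
        using is_sup_upper[OF z, of "(y, s + b)"] Dcar[OF p(1)] lower[OF p(1)] p(2) u(1) b by simp
    qed (use zX in auto)
    then have "z = x0" using u zX x0X by (intro d_antisym) auto
    then show ?thesis using z u by simp
  qed
  have "0 \<le> \<rho>" using Dcar by (intro greatest)
  then have sup': "is_sup B D (x0, \<rho>)" using main[of \<rho>] by simp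
  have "(x, r) \<sqsubseteq>\<^bsub>B\<^esub> (x0, \<rho>)" "(x0, \<rho>) \<sqsubseteq>\<^bsub>B\<^esub> (x, r)"
    using is_sup_least[OF sup is_sup_carrier[OF sup']] is_sup_least[OF sup' is_sup_carrier[OF sup]]
      is_sup_upper[OF sup] is_sup_upper[OF sup'] by blast+
  then have eq: "r = \<rho>" "x = x0"
    using is_sup_carrier[OF sup] x0X by (auto intro: d_antisym)
  then show "r = Inf (snd ` D)" by (simp add: \<rho>_def)
  show "is_sup B (shift c D) (x, r + c)" if "0 \<le> r + c"
    using main[OF that] eq by simp
qed

lemmas sup_radius = sup_radius_and_shift(1)
lemmas sup_shift = sup_radius_and_shift(2)

lemma sup_radius_le:
  assumes "directed_in B D" "is_sup B D (x, r)" "(y, s) \<in> D"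
  shows "r \<le> s"
  using is_sup_upper[OF assms(2,3)] directed_in_subset[OF assms(1)] assms(3) by auto

lemma sup_radius_approx:
  assumes "directed_in B D" "is_sup B D (x, r)" "r < b"
  shows "\<exists>(y, s)\<in>D. s < b"
proof -
  have "Inf (snd ` D) < b" using assms sup_radius by blast
  then show ?thesis using cInf_lessD[of "snd ` D" b] directed_in_nonempty[OF assms(1)] by force
qed

text \<open>Unlike in the definition of suprema, the radius \<open>t\<close> may be negative here.\<close>

lemma sup_least_ball:
  assumes D: "directed_in B D" "is_sup B D (x, r)" and z: "z \<in> X"
    and ub: "\<And>y s. (y, s) \<in> D \<Longrightarrow> t \<le> s \<and> d y z \<le> ennreal (s - t)"
  shows "t \<le> r \<and> d x z \<le> ennreal (r - t)"
proof -
  have "t \<le> Inf (snd ` D)"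
    using ub directed_in_nonempty[OF D(1)] by (intro cInf_greatest) auto
  then have t: "t \<le> r" using sup_radius[OF D] by simp
  \<comment> \<open>Translation by \<open>-t\<close> turns the possibly virtual bound
    \<open>(z, t)\<close> into the genuine ball \<open>(z, 0)\<close>.\<close>
  then have "is_sup B (shift (-t) D) (x, r - t)" using sup_shift[OF D, of "-t"] by simp
  then have "(x, r - t) \<sqsubseteq>\<^bsub>B\<^esub> (z, 0)"
    by (rule is_sup_least) (use z ub in \<open>fastforce simp: shift_iff\<close>)+
  then show ?thesis using t by simp
qed

text \<open>This is the preimage of \<open>V\<close> under translation of radii by \<open>c\<close>;
  balls whose translated radius would be negative are added so that the set stays upwards closed.
  Suprema are respected because they commute with translation, and the added balls are handled by
  the radius of a supremum being an infimum.\<close>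

lemma scott_open_shift:
  assumes V: "scott_open B V"
  shows "scott_open B {(x, t). x \<in> X \<and> 0 \<le> t \<and> (t + c < 0 \<or> (x, t + c) \<in> V)}"
proof (rule scott_openI)
  fix p q assume p: "p \<in> {(x, t). x \<in> X \<and> 0 \<le> t \<and> (t + c < 0 \<or> (x, t + c) \<in> V)}"
    and q: "q \<in> carrier B" "p \<sqsubseteq>\<^bsub>B\<^esub> q"
  obtain x t y s where eq: "p = (x, t)" "q = (y, s)" by (cases p; cases q)
  have "(x, t + c) \<sqsubseteq>\<^bsub>B\<^esub> (y, s + c)" using q eq by simp
  then have "(y, s + c) \<in> V" if "(x, t + c) \<in> V" "0 \<le> s + c"
    using q eq that scott_open_upward[OF V, of "(x, t + c)" "(y, s + c)"] by simp
  then show "q \<in> {(x, t). x \<in> X \<and> 0 \<le> t \<and> (t + c < 0 \<or> (x, t + c) \<in> V)}"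
    using p q eq by force
next
  fix D p assume D: "directed_in B D" "is_sup B D p"
    and p: "p \<in> {(x, t). x \<in> X \<and> 0 \<le> t \<and> (t + c < 0 \<or> (x, t + c) \<in> V)}"
  obtain x t where eq: "p = (x, t)" by (cases p)
  have car: "y \<in> X" "0 \<le> s" if "(y, s) \<in> D" for y s
    using directed_in_subset[OF D(1)] that by auto
  show "\<exists>p\<in>D. p \<in> {(x, t). x \<in> X \<and> 0 \<le> t \<and> (t + c < 0 \<or> (x, t + c) \<in> V)}"
  proof (cases "t + c < 0")
    case True
    then obtain y s where "(y, s) \<in> D" "s < - c"
      using sup_radius_approx[OF D(1) D(2)[unfolded eq], of "-c"] by auto
    then show ?thesis using car by (intro bexI[of _ "(y, s)"]) auto
  next
    case False
    then have sup: "is_sup B (shift c D) (x, t + c)"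
      using sup_shift[OF D(1) D(2)[unfolded eq]] by simp
    have "directed_in B (shift c D)"
      using D(1) by (rule directed_shift) (use sup_radius_le[OF D(1) D(2)[unfolded eq]] False in fastforce)
    then obtain q where "q \<in> shift c D" "q \<in> V"
      using scott_open_sup[OF V _ sup] p eq False by auto
    then show ?thesis using car unfolding shift_def by (force)
  qed
qed auto

section \<open>Slices of Scott-open sets and uniform estimates on compact sets\<close>

lemma openin_slice:
  assumes "scott_open B V" "0 \<le> c"
  shows "openin (d_scott_topology X d) {x \<in> X. (x, c) \<in> V}"
  unfolding openin_d_scott_topology
  using scott_open_shift[OF assms(1), of c] assms(2) by (force)

text \<open>Makes the set of balls \<open>(x, c)\<close> with \<open>x\<close> in a compact set
  compact in the ball poset.\<close>

lemma continuous_map_ball: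
  "0 \<le> c \<Longrightarrow> continuous_map (d_scott_topology X d) (scott_topology B) (\<lambda>x. (x, c))"
  unfolding continuous_map_def using openin_slice by (auto simp: openin_scott_topology)

lemma scott_open_not_le:
  assumes "z \<in> X" "0 \<le> t"
  shows "scott_open B {p \<in> carrier B. \<not> p \<sqsubseteq>\<^bsub>B\<^esub> (z, t)}"
proof (rule scott_open_not_below)
  show "(z, t) \<in> carrier B" using assms by simp
  then show "p \<sqsubseteq>\<^bsub>B\<^esub> (z, t)"
    if "p \<in> carrier B" "q \<in> carrier B" "p \<sqsubseteq>\<^bsub>B\<^esub> q" "q \<sqsubseteq>\<^bsub>B\<^esub> (z, t)" for p q
    using B.le_trans that by blast
qed

lemma openin_d_greater:
  assumes "z \<in> X" "0 \<le> c"
  shows "openin (d_scott_topology X d) {x \<in> X. \<not> d x z \<le> ennreal c}"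
  using openin_slice[OF scott_open_not_le[OF assms(1) order_refl] assms(2)] assms(2)
  by (simp add: conj_commute cong: conj_cong)

text \<open>The open sets \<open>?U n\<close> increase and cover \<open>Q\<close>, so the bound
  \<open>t\<close> is exceeded with a uniform margin. This does the work of attainment of the
  infimum of \<open>d x z\<close> over \<open>Q\<close>.\<close>

lemma compact_distance_gap:
  assumes Q: "compactin (d_scott_topology X d) Q" and z: "z \<in> X" and "0 \<le> t"
    and far: "\<And>x. x \<in> Q \<Longrightarrow> \<not> d x z \<le> ennreal t"
  shows "\<exists>c>t. \<forall>x\<in>Q. \<not> d x z \<le> ennreal c"
proof -
  let ?U = "\<lambda>n. {x \<in> X. \<not> d x z \<le> ennreal (t + inverse (real (Suc n)))}"
  have "\<exists>n. Q \<subseteq> ?U n"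
  proof (rule compactin_incseq_cover[OF Q])
    show "openin (d_scott_topology X d) (?U n)" for n
      by (rule openin_d_greater[OF z]) (use \<open>0 \<le> t\<close> in simp)
    show "incseq ?U"
    proof (rule incseq_SucI, rule subsetI)
      fix n x assume x: "x \<in> ?U n"
      have "ennreal (t + inverse (real (Suc (Suc n)))) \<le> ennreal (t + inverse (real (Suc n)))"
        by (intro ennreal_leI add_left_mono le_imp_inverse_le) auto
      then show "x \<in> ?U (Suc n)" using x by (auto dest: order_trans)
    qed
    show "Q \<subseteq> (\<Union>n. ?U n)"
      using far ennreal_le_if_le_inverse[OF _ \<open>0 \<le> t\<close>] compactin_subset_topspace[OF Q] by fastforce
  qed
  then obtain n where "Q \<subseteq> ?U n" by blast
  then show ?thesis by (intro exI[of _ "t + inverse (real (Suc n))"]) auto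
qed

lemma d_zero_le_trans: "d x y \<le> ennreal r \<Longrightarrow> d y z = 0 \<Longrightarrow> x \<in> X \<Longrightarrow> y \<in> X \<Longrightarrow> z \<in> X \<Longrightarrow> d x z \<le> ennreal r"
  using d_triangle[of x y z] by (metis add.right_neutral order_trans)

lemma zero_d_le_trans: "d x y = 0 \<Longrightarrow> d y z \<le> ennreal r \<Longrightarrow> x \<in> X \<Longrightarrow> y \<in> X \<Longrightarrow> z \<in> X \<Longrightarrow> d x z \<le> ennreal r"
  using d_triangle[of x y z] by (metis add.left_neutral order_trans)

text \<open>Each \<open>(x, 0)\<close> is the supremum of the balls around \<open>x\<close> of
  radius \<open>inverse (real (Suc n))\<close>, so Scott-openness leaves room at every point;
  compactness makes the room uniform.\<close>

lemma scott_open_uniform_radius: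
  assumes Q: "compactin (d_scott_topology X d) Q" and V: "scott_open B V"
    and sub: "\<And>x. x \<in> Q \<Longrightarrow> (x, 0) \<in> V" and "0 < \<delta>"
  shows "\<exists>\<epsilon>. 0 < \<epsilon> \<and> \<epsilon> < \<delta> \<and> (\<forall>x\<in>Q. (x, \<epsilon>) \<in> V)"
proof -
  let ?r = "\<lambda>n. inverse (real (Suc n))"
  let ?U = "\<lambda>n. {x \<in> X. (x, ?r n) \<in> V}"
  have QX: "Q \<subseteq> X" using compactin_subset_topspace[OF Q] by simp
  have anti: "(x, r) \<in> V" if "(x, s) \<in> V" "0 \<le> r" "r \<le> s" "x \<in> X" for x r s
    using scott_open_upward[OF V that(1), of "(x, r)"] that by simp
  have "\<exists>n. Q \<subseteq> ?U n"
  proof (rule compactin_incseq_cover[OF Q])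
    show "openin (d_scott_topology X d) (?U n)" for n by (rule openin_slice[OF V]) simp
    show "incseq ?U"
    proof (rule incseq_SucI, rule subsetI)
      fix n x assume "x \<in> ?U n"
      moreover have "?r (Suc n) \<le> ?r n" by (intro le_imp_inverse_le) auto
      ultimately show "x \<in> ?U (Suc n)" using anti[of x "?r n" "?r (Suc n)"] by simp
    qed
    show "Q \<subseteq> (\<Union>n. ?U n)"
    proof
      fix x assume x: "x \<in> Q"
      then have xX: "x \<in> X" using QX by auto
      let ?D = "range (\<lambda>n. (x, ?r n))"
      have dir: "directed_in B ?D"
      proof (rule directed_inI)
        fix p q assume "p \<in> ?D" "q \<in> ?D"
        then obtain m n where mn: "p = (x, ?r m)" "q = (x, ?r n)" by auto
        have "?r (max m n) \<le> ?r m" "?r (max m n) \<le> ?r n"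
          by (intro le_imp_inverse_le; simp)+
        then show "\<exists>w\<in>?D. p \<sqsubseteq>\<^bsub>B\<^esub> w \<and> q \<sqsubseteq>\<^bsub>B\<^esub> w"
          using mn xX by (intro bexI[of _ "(x, ?r (max m n))"]) (auto simp del: of_nat_Suc)
      qed (use xX in auto)
      have "is_sup B ?D (x, 0)"
      proof (rule is_supI)
        fix p assume p: "p \<in> carrier B" "\<And>q. q \<in> ?D \<Longrightarrow> q \<in> carrier B \<Longrightarrow> q \<sqsubseteq>\<^bsub>B\<^esub> p"
        obtain y s where eq: "p = (y, s)" by (cases p)
        have le: "s \<le> ?r n \<and> d x y \<le> ennreal (?r n - s)" for n
          using p(2)[of "(x, ?r n)"] xX eq by simp
        have "s \<le> 0"
        proof (rule ccontr)
          assume "\<not> s \<le> 0"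
          then obtain n where "?r n < s" using reals_Archimedean[of s] by auto
          then show False using le[of n] by linarith
        qed
        then have "s = 0" using p eq by auto
        moreover then have "d x y \<le> ennreal (0 + ?r n)" for n using le[of n] by simp
        then have "d x y \<le> ennreal 0" by (rule ennreal_le_if_le_inverse) simp
        ultimately show "(x, 0) \<sqsubseteq>\<^bsub>B\<^esub> p" using eq by simp
      qed (use xX in auto)
      then obtain p where "p \<in> ?D" "p \<in> V" using scott_open_sup[OF V dir] sub[OF x] by blast
      then show "x \<in> (\<Union>n. ?U n)" using xX by auto
    qed
  qed
  then obtain n where n: "Q \<subseteq> ?U n" by blast
  let ?e = "min (?r n) (\<delta> / 2)"
  have "(x, ?e) \<in> V" if "x \<in> Q" for x
    using anti[of x "?r n" ?e] n that QX \<open>0 < \<delta>\<close> by auto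
  then show ?thesis using \<open>0 < \<delta>\<close> by (intro exI[of _ ?e]) (auto simp: min_def)
qed

section \<open>Finite approximation of compact sets\<close>

text \<open>Two demands meet in one approximant \<open>(y, s)\<close> of \<open>(x, 0)\<close> by
  directedness: \<open>s < \<epsilon>\<close> puts \<open>(y, \<epsilon>)\<close> below it and hence
  way below \<open>(x, 0)\<close>, while translating the approximants by \<epsilon> gives a family
  with supremum \<open>(x, \<epsilon>)\<close>, which enters \<open>V\<close>.\<close>

lemma ball_approximation:
  assumes x: "x \<in> X" and "0 < \<epsilon>" and V: "scott_open B V" "(x, \<epsilon>) \<in> V"
  shows "\<exists>y\<in>X. way_below B (y, \<epsilon>) (x, 0) \<and> (y, \<epsilon>) \<in> V"
proof -
  obtain D where D: "directed_in B D" "\<And>p. p \<in> D \<Longrightarrow> way_below B p (x, 0)" "is_sup B D (x, 0)"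
    using B.approximants[of "(x, 0)"] x by auto
  have car: "y \<in> X" "0 \<le> s" if "(y, s) \<in> D" for y s
    using directed_in_subset[OF D(1)] that by auto
  have "directed_in B (shift \<epsilon> D)"
    using D(1) by (rule directed_shift) (use car \<open>0 < \<epsilon>\<close> in force)
  moreover have "is_sup B (shift \<epsilon> D) (x, \<epsilon>)" using sup_shift[OF D(1,3), of \<epsilon>] \<open>0 < \<epsilon>\<close> by simp
  ultimately obtain p where "p \<in> shift \<epsilon> D" "p \<in> V"
    using scott_open_sup[OF V(1)] V(2) by blast
  then obtain y1 s1 where 1: "(y1, s1) \<in> D" "(y1, s1 + \<epsilon>) \<in> V" unfolding shift_def by auto
  obtain y2 s2 where 2: "(y2, s2) \<in> D" "s2 < \<epsilon>"
    using sup_radius_approx[OF D(1,3) \<open>0 < \<epsilon>\<close>] by auto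
  obtain y s where y: "(y, s) \<in> D" "(y1, s1) \<sqsubseteq>\<^bsub>B\<^esub> (y, s)" "(y2, s2) \<sqsubseteq>\<^bsub>B\<^esub> (y, s)"
    using directed_inD[OF D(1) 1(1) 2(1)] by auto
  have s: "0 \<le> s" "s < \<epsilon>" "y \<in> X" using y 2 car by auto
  have "(y, s + \<epsilon>) \<in> V"
    using scott_open_upward[OF V(1) 1(2), of "(y, s + \<epsilon>)"] y s by simp
  then have "(y, \<epsilon>) \<in> V"
    using scott_open_upward[OF V(1), of "(y, s + \<epsilon>)" "(y, \<epsilon>)"] s by simp
  moreover have "way_below B (y, \<epsilon>) (x, 0)"
    by (rule B.le_way_below_trans[OF _ D(2)[OF y(1)]]) (use s in auto)
  ultimately show ?thesis using s by blast
qed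

text \<open>A common radius \<epsilon> is fixed before the centres are chosen; the sets of points
  way above the balls \<open>(y, \<epsilon>)\<close> then form an open cover, and \<open>E\<close>
  collects the centres of a finite subcover.\<close>

lemma finite_approximation:
  assumes Q: "Q \<in> smyth X d" and V: "scott_open B V"
    and sub: "\<And>x. x \<in> Q \<Longrightarrow> (x, 0) \<in> V" and "0 < \<delta>"
  shows "\<exists>\<epsilon> E. 0 < \<epsilon> \<and> \<epsilon> < \<delta> \<and> finite E \<and> E \<noteq> {} \<and> E \<subseteq> X \<and> (\<forall>y\<in>E. (y, \<epsilon>) \<in> V) \<and>
    (\<forall>x\<in>Q. \<exists>y\<in>E. way_below B (y, \<epsilon>) (x, 0))"
proof -
  obtain \<epsilon> where \<epsilon>: "0 < \<epsilon>" "\<epsilon> < \<delta>" "\<forall>x\<in>Q. (x, \<epsilon>) \<in> V"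
    using scott_open_uniform_radius[OF smyth_compact[OF Q] V sub \<open>0 < \<delta>\<close>] by blast
  let ?Y = "{y \<in> X. (y, \<epsilon>) \<in> V}"
  let ?W = "\<lambda>y. {x \<in> X. (x, 0) \<in> {p \<in> carrier B. way_below B (y, \<epsilon>) p}}"
  have cover: "Q \<subseteq> \<Union>(?W ` ?Y)"
  proof
    fix x assume "x \<in> Q"
    then have "x \<in> X" "(x, \<epsilon>) \<in> V" using smyth_subset[OF Q] \<epsilon> by auto
    then show "x \<in> \<Union>(?W ` ?Y)" using ball_approximation[OF _ \<epsilon>(1) V] by auto
  qed
  have op: "openin (d_scott_topology X d) U" if "U \<in> ?W ` ?Y" for U
    using that openin_slice[OF B.scott_open_way_above] \<epsilon>(1) by force
  obtain \<F> where F: "finite \<F>" "\<F> \<subseteq> ?W ` ?Y" "Q \<subseteq> \<Union>\<F>"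
    using compactinD[OF smyth_compact[OF Q] op cover] by blast
  obtain E where E: "E \<subseteq> ?Y" "finite E" "\<F> = ?W ` E"
    using finite_subset_image[OF F(1,2)] by blast
  have "\<exists>y\<in>E. way_below B (y, \<epsilon>) (x, 0)" if "x \<in> Q" for x
  proof -
    obtain U where "U \<in> ?W ` E" "x \<in> U" using F(3) E(3) \<open>x \<in> Q\<close> by blast
    then show ?thesis by blast
  qed
  moreover then have "E \<noteq> {}" using smyth_nonempty[OF Q] by blast
  ultimately show ?thesis using \<epsilon> E(1,2) by (intro exI[of _ \<epsilon>] exI[of _ E]) blast
qed

text \<open>Open sets are upwards closed for the specialization ordering, so any open cover of the
  finite set \<open>E\<close> already covers its upward closure.\<close>

lemma upward_closure_smyth:
  assumes "finite E" "E \<noteq> {}" "E \<subseteq> X"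
  shows "{y \<in> X. \<exists>x\<in>E. d x y = 0} \<in> smyth X d"
proof -
  let ?Q = "{y \<in> X. \<exists>x\<in>E. d x y = 0}"
  have EQ: "E \<subseteq> ?Q" using assms(3) d_refl by blast
  have "compactin (d_scott_topology X d) ?Q"
    unfolding compactin_def
  proof (intro conjI allI impI; (elim conjE)?)
    fix \<U> assume U: "\<forall>U\<in>\<U>. openin (d_scott_topology X d) U" "?Q \<subseteq> \<Union>\<U>"
    then have "E \<subseteq> \<Union>\<U>" using EQ by blast
    moreover have "compactin (d_scott_topology X d) E"
      using assms by (intro finite_imp_compactin) auto
    ultimately obtain \<F> where F: "finite \<F>" "\<F> \<subseteq> \<U>" "E \<subseteq> \<Union>\<F>"
      using U(1) unfolding compactin_def by metis
    have "y \<in> \<Union>\<F>" if y: "y \<in> ?Q" for y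
    proof -
      obtain x where x: "x \<in> E" "d x y = 0" "y \<in> X" "x \<in> X" using y assms(3) by blast
      then obtain U where "U \<in> \<F>" "x \<in> U" using F(3) by blast
      moreover then obtain V where "scott_open B V" "U = {x \<in> X. (x, 0) \<in> V}"
        using U(1) F(2) unfolding openin_d_scott_topology by blast
      ultimately show ?thesis
        using scott_open_upward[of B V "(x, 0)" "(y, 0)"] x by auto
    qed
    then show "\<exists>\<F>. finite \<F> \<and> \<F> \<subseteq> \<U> \<and> ?Q \<subseteq> \<Union>\<F>" using F(1,2) by blast
  qed auto
  moreover have "z \<in> ?Q" if yz: "y \<in> ?Q" "z \<in> X" "d y z = 0" for y z
  proof -
    obtain x where x: "x \<in> E" "d x y = 0" "y \<in> X" "x \<in> X" using yz(1) assms(3) by blast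
    then have "d x z \<le> ennreal 0" using d_zero_le_trans[of x y 0 z] yz by simp
    then show ?thesis using x yz by auto
  qed
  ultimately show ?thesis using EQ assms(2) unfolding smyth_def by blast
qed

end


section \<open>Lipschitz maps and the Smyth distance\<close>

lemma d_R_le_iff: "0 \<le> t \<Longrightarrow> d_R u v \<le> ennreal t \<longleftrightarrow> u \<le> v + ennreal t"
proof (cases "u \<le> v")
  case True
  then have "u \<le> v + ennreal t" by (simp add: add_increasing2)
  then show ?thesis using True by (simp add: d_R_def)
next
  case False
  show ?thesis
  proof (cases "u = \<infinity>")
    case True
    then show ?thesis using False
      by (auto simp: d_R_def top_unique ennreal_add_eq_top infinity_ennreal_def)
  next
    case fin: False
    then show ?thesis using False
      by (auto simp: d_R_def ennreal_minus_le_iff infinity_ennreal_def)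
  qed
qed

lemma d_R_ball_le:
  "(u, r) \<sqsubseteq>\<^bsub>formal_balls UNIV d_R\<^esub> (v, s) \<longleftrightarrow> s \<le> r \<and> u \<le> v + ennreal (r - s)"
  by (auto simp: d_R_le_iff)

lemma ennreal_real_between:
  assumes "ennreal c < a"
  shows "\<exists>b>c. ennreal b < a"
proof (cases a)
  case (real r)
  then have "c < r" using assms by (metis ennreal_leI not_less)
  moreover have "0 < r" using assms real by (auto simp: zero_less_iff_neq_zero intro!: le_neq_trans)
  ultimately show ?thesis using real
    by (intro exI[of _ "(c + r) / 2"]) (auto simp: ennreal_less_iff intro!: ennreal_lessI)
next
  case top
  then show ?thesis by (intro exI[of _ "c + 1"]) simp
qed

context yoneda_complete
begin

text \<open>Balls not below \<open>(h y, 0)\<close> form a Scott-open set, whose preimage is upwards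
  closed. If the inequality failed, the preimage would contain \<open>(x, t)\<close> and therefore
  \<open>(y, 0)\<close>, which is absurd.\<close>

lemma lipschitz1_continuousD:
  assumes h: "lipschitz1_continuous X d h" and xy: "x \<in> X" "y \<in> X" "0 \<le> t" "d x y \<le> ennreal t"
  shows "h x \<le> h y + ennreal t"
proof (rule ccontr)
  assume contra: "\<not> h x \<le> h y + ennreal t"
  let ?R = "formal_balls UNIV d_R"
  let ?V = "{p \<in> carrier ?R. \<not> p \<sqsubseteq>\<^bsub>?R\<^esub> (h y, 0)}"
  have "scott_open ?R ?V"
  proof (rule scott_open_not_below)
    fix p q assume pq: "p \<in> carrier ?R" "q \<in> carrier ?R" "p \<sqsubseteq>\<^bsub>?R\<^esub> q" "q \<sqsubseteq>\<^bsub>?R\<^esub> (h y, 0)"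
    obtain u r v s where eq: "p = (u, r)" "q = (v, s)" by (cases p; cases q)
    have 1: "s \<le> r" "u \<le> v + ennreal (r - s)" "0 \<le> s" "v \<le> h y + ennreal s"
      using pq eq unfolding d_R_ball_le by (auto simp: d_R_le_iff)
    then have "u \<le> (h y + ennreal s) + ennreal (r - s)"
      by (meson add_right_mono order_trans)
    also have "\<dots> = h y + ennreal r" using 1 by (simp add: add.assoc flip: ennreal_plus)
    finally show "p \<sqsubseteq>\<^bsub>?R\<^esub> (h y, 0)" using 1 eq by (simp add: d_R_le_iff)
  qed auto
  then have "openin (scott_topology B) {p \<in> carrier B. (\<lambda>(x, r). (h x, r)) p \<in> ?V}"
    using h unfolding lipschitz1_continuous_def continuous_map_def openin_scott_topology by auto
  then have "scott_open B {p \<in> carrier B. (\<lambda>(x, r). (h x, r)) p \<in> ?V}"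
    by (simp add: openin_scott_topology)
  then have "(y, 0) \<in> {p \<in> carrier B. (\<lambda>(x, r). (h x, r)) p \<in> ?V}"
    by (rule scott_open_upward[of _ _ "(x, t)"]) (use xy contra in \<open>auto simp: d_R_le_iff\<close>)
  then show False by (simp add: d_R_def)
qed

text \<open>These are the test functions that detect the Smyth distance; truncation at
  \<open>a\<close> makes them admissible for the bounded variant. The ball map preserves directed
  suprema, and only the effect of the truncation on this needs care.\<close>

lemma lipschitz1_continuous_truncated_distance:
  assumes z: "z \<in> X"
  shows "lipschitz1_continuous X d (\<lambda>x. min a (d x z))"
proof -
  let ?R = "formal_balls UNIV d_R"
  let ?h = "\<lambda>x. min a (d x z)"
  let ?g = "\<lambda>(x, r). (?h x, r :: real)"
  have mono: "?g p \<sqsubseteq>\<^bsub>?R\<^esub> ?g q" if pq: "p \<in> carrier B" "q \<in> carrier B" "p \<sqsubseteq>\<^bsub>B\<^esub> q" for p q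
  proof -
    obtain x r y s where eq: "p = (x, r)" "q = (y, s)" by (cases p; cases q)
    have 1: "x \<in> X" "y \<in> X" "s \<le> r" "d x y \<le> ennreal (r - s)" using pq eq by auto
    then have "d x z \<le> d y z + ennreal (r - s)"
      using d_triangle[OF 1(1,2) z] by (metis add.commute add_left_mono order_trans)
    moreover have "a \<le> a + ennreal (r - s)" by (simp add: add_increasing2)
    ultimately have "?h x \<le> a + ennreal (r - s)" "?h x \<le> d y z + ennreal (r - s)"
      by (auto intro: min.coboundedI1 min.coboundedI2)
    then have "?h x \<le> ?h y + ennreal (r - s)" by (cases "a \<le> d y z") (simp_all add: min_def)
    then show ?thesis unfolding eq prod.case d_R_ball_le using 1(3) by blast
  qed
  have "scott_open B {p \<in> carrier B. ?g p \<in> W}" if W: "scott_open ?R W" for W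
  proof (rule scott_openI)
    fix p q assume "p \<in> {p \<in> carrier B. ?g p \<in> W}" "q \<in> carrier B" "p \<sqsubseteq>\<^bsub>B\<^esub> q"
    then show "q \<in> {p \<in> carrier B. ?g p \<in> W}"
      using scott_open_upward[OF W _ _ mono[of p q]] by auto
  next
    fix D p assume D: "directed_in B D" "is_sup B D p" and p: "p \<in> {p \<in> carrier B. ?g p \<in> W}"
    obtain x r where eq: "p = (x, r)" by (cases p)
    note sup = D(2)[unfolded eq]
    have car: "y \<in> X" "0 \<le> s" if "(y, s) \<in> D" for y s
      using directed_in_subset[OF D(1)] that by auto
    have x: "x \<in> X" "0 \<le> r" using is_sup_carrier[OF sup] by auto
    have dir: "directed_in ?R (?g ` D)"
    proof (rule directed_inI)
      show "?g ` D \<subseteq> carrier ?R" using car by auto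
      show "?g ` D \<noteq> {}" using directed_in_nonempty[OF D(1)] by auto
      fix p' q' assume "p' \<in> ?g ` D" "q' \<in> ?g ` D"
      then obtain p q where pq: "p' = ?g p" "q' = ?g q" "p \<in> D" "q \<in> D" by blast
      then obtain w where "w \<in> D" "p \<sqsubseteq>\<^bsub>B\<^esub> w" "q \<sqsubseteq>\<^bsub>B\<^esub> w" using directed_inD[OF D(1)] by blast
      then show "\<exists>w\<in>?g ` D. p' \<sqsubseteq>\<^bsub>?R\<^esub> w \<and> q' \<sqsubseteq>\<^bsub>?R\<^esub> w"
        using mono pq directed_in_subset[OF D(1)] by blast
    qed
    have "is_sup ?R (?g ` D) (?g (x, r))"
    proof (rule is_supI)
      show "?g (x, r) \<in> carrier ?R" using x by simp
      show "w \<sqsubseteq>\<^bsub>?R\<^esub> ?g (x, r)" if "w \<in> ?g ` D" for w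
        using that mono is_sup_upper[OF sup] directed_in_subset[OF D(1)] is_sup_carrier[OF sup] by blast
      fix w assume w: "w \<in> carrier ?R" "\<And>q. q \<in> ?g ` D \<Longrightarrow> q \<in> carrier ?R \<Longrightarrow> q \<sqsubseteq>\<^bsub>?R\<^esub> w"
      obtain v s where weq: "w = (v, s)" by (cases w)
      have ub: "s \<le> t" "?h y \<le> v + ennreal (t - s)" if "(y, t) \<in> D" for y t
      proof -
        have "(?h y, t) \<in> ?g ` D" using that by force
        then have "(?h y, t) \<sqsubseteq>\<^bsub>?R\<^esub> (v, s)"
          unfolding weq[symmetric] by (rule w(2)) (use car[OF that] in simp)
        then show "s \<le> t" "?h y \<le> v + ennreal (t - s)" unfolding d_R_ball_le by auto
      qed
      have sr: "s \<le> r"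
        unfolding sup_radius[OF D(1) sup] using ub(1) directed_in_nonempty[OF D(1)]
        by (intro cInf_greatest) auto
      have "?h x \<le> v + ennreal (r - s)"
      proof (cases "a \<le> v + ennreal (r - s)")
        case True
        then show ?thesis by (rule min.coboundedI1)
      next
        case False
        then obtain c where c: "v = ennreal c" "0 \<le> c" by (cases v) auto
        have "ennreal (c + (r - s)) < a" using False c sr by (simp add: not_le)
        \<comment> \<open>The number \<open>b\<close> lies strictly between the bound to be proved
          and the cap \<open>a\<close>. Balls of \<open>D\<close> with radius below
          \<open>b - c + s\<close> are too small for the minimum to be \<open>a\<close>, so there
          the upper bound \<open>w\<close> constrains \<open>d\<close> itself.\<close>
        then obtain b where b: "c + (r - s) < b" "ennreal b < a" using ennreal_real_between by blast
        then have "r < b - c + s" by simp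
        then obtain y0 t0 where 0: "(y0, t0) \<in> D" "t0 < b - c + s"
          using sup_radius_approx[OF D(1) sup] by blast
        \<comment> \<open>In effect \<open>(z, s - c)\<close> bounds \<open>D\<close>, with a radius
          that may be negative. The estimate is obtained at a ball beyond \<open>(y0, t0)\<close>
          and carried back to \<open>(y, t)\<close> by the triangle inequality.\<close>
        have "s - c \<le> t \<and> d y z \<le> ennreal (t - (s - c))" if yt: "(y, t) \<in> D" for y t
        proof -
          obtain y' t' where 1: "(y', t') \<in> D" "(y0, t0) \<sqsubseteq>\<^bsub>B\<^esub> (y', t')" "(y, t) \<sqsubseteq>\<^bsub>B\<^esub> (y', t')"
            using directed_inD[OF D(1) 0(1) yt] by auto
          then have 2: "t' \<le> t0" "t' \<le> t" "d y y' \<le> ennreal (t - t')" "s \<le> t'" using ub by auto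
          have "ennreal (c + (t' - s)) \<le> ennreal b" using 2 0 by (intro ennreal_leI) simp
          then have "ennreal c + ennreal (t' - s) < a" using b(2) c(2) 2 by (simp add: ennreal_plus)
          then have "d y' z \<le> ennreal c + ennreal (t' - s)"
            using ub(2)[OF 1(1)] c(1) by (auto simp: min_def split: if_splits)
          then have "d y z \<le> ennreal (t - t') + (ennreal c + ennreal (t' - s))"
            using d_triangle[of y y' z] car[OF yt] car[OF 1(1)] z 2(3) by (meson add_mono order_trans)
          also have "\<dots> = ennreal (t - (s - c))"
            using 2 c(2) by (simp flip: ennreal_plus)
          finally show ?thesis using 2 c(2) by simp
        qed
        then have "d x z \<le> ennreal (r - (s - c))" using sup_least_ball[OF D(1) sup z] by blast
        also have "\<dots> = v + ennreal (r - s)" using c sr by (simp flip: ennreal_plus)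
        finally show ?thesis by (rule min.coboundedI2)
      qed
      then show "?g (x, r) \<sqsubseteq>\<^bsub>?R\<^esub> w" using sr unfolding weq prod.case d_R_ball_le by blast
    qed
    then obtain w where "w \<in> ?g ` D" "w \<in> W" using scott_open_sup[OF W dir] p eq by blast
    then show "\<exists>q\<in>D. q \<in> {p \<in> carrier B. ?g p \<in> W}" using directed_in_subset[OF D(1)] by blast
  qed auto
  then show ?thesis
    unfolding lipschitz1_continuous_def continuous_map_def openin_scott_topology by auto
qed

definition truncated_d_Q :: "ennreal \<Rightarrow> 'a set \<Rightarrow> 'a set \<Rightarrow> ennreal" where
  "truncated_d_Q a Q Q' =
     (SUP h \<in> {h. lipschitz1_continuous X d h \<and> (\<forall>x\<in>X. h x \<le> a)}.
        d_R (INF x\<in>Q. h x) (INF x\<in>Q'. h x))"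

text \<open>A point \<open>z\<close> of \<open>Q'\<close> farther than \<open>t\<close> from all of
  \<open>Q\<close> is exposed by the function \<open>min a (d x z)\<close> of \<open>x\<close>: it
  vanishes at \<open>z\<close> and is at least \<open>min a c\<close> on \<open>Q\<close>, for some
  \<open>c > t\<close> provided by compactness. The converse is the Lipschitz inequality, or just
  the bound on \<open>h\<close> when \<open>a \<le> t\<close>.\<close>

lemma truncated_d_Q_le_iff:
  assumes Q: "Q \<in> smyth X d" and Q': "Q' \<in> smyth X d" and t: "0 \<le> t"
  shows "truncated_d_Q a Q Q' \<le> ennreal t \<longleftrightarrow>
    a \<le> ennreal t \<or> (\<forall>z\<in>Q'. \<exists>x\<in>Q. d x z \<le> ennreal t)"
proof
  assume le: "truncated_d_Q a Q Q' \<le> ennreal t"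
  show "a \<le> ennreal t \<or> (\<forall>z\<in>Q'. \<exists>x\<in>Q. d x z \<le> ennreal t)"
  proof (rule ccontr)
    assume "\<not> ?thesis"
    then obtain z where z: "\<not> a \<le> ennreal t" "z \<in> Q'" "\<And>x. x \<in> Q \<Longrightarrow> \<not> d x z \<le> ennreal t" by blast
    have zX: "z \<in> X" using z(2) smyth_subset[OF Q'] by blast
    obtain c where c: "c > t" "\<forall>x\<in>Q. \<not> d x z \<le> ennreal c"
      using compact_distance_gap[OF smyth_compact[OF Q] zX t z(3)] by blast
    let ?h = "\<lambda>x. min a (d x z)"
    have "d_R (INF x\<in>Q. ?h x) (INF x\<in>Q'. ?h x) \<le> truncated_d_Q a Q Q'"
      unfolding truncated_d_Q_def
      by (rule SUP_upper) (use lipschitz1_continuous_truncated_distance[OF zX] in auto)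
    then have "(INF x\<in>Q. ?h x) \<le> (INF x\<in>Q'. ?h x) + ennreal t"
      using le d_R_le_iff[OF t] order_trans by blast
    moreover have "(INF x\<in>Q'. ?h x) \<le> ?h z" using z(2) by (rule INF_lower)
    moreover have "?h z = 0" using zX by simp
    ultimately have "(INF x\<in>Q. ?h x) \<le> ennreal t" by simp
    moreover have "min a (ennreal c) \<le> (INF x\<in>Q. ?h x)"
      using c(2) by (intro INF_greatest) (auto simp: min_def not_le)
    ultimately have "min a (ennreal c) \<le> ennreal t" by (rule order_trans[rotated])
    then show False using z(1) c(1) t by (auto simp: min_def ennreal_le_iff2 split: if_splits)
  qed
next
  assume le: "a \<le> ennreal t \<or> (\<forall>z\<in>Q'. \<exists>x\<in>Q. d x z \<le> ennreal t)"
  show "truncated_d_Q a Q Q' \<le> ennreal t"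
    unfolding truncated_d_Q_def
  proof (rule SUP_least)
    fix h assume "h \<in> {h. lipschitz1_continuous X d h \<and> (\<forall>x\<in>X. h x \<le> a)}"
    then have h: "lipschitz1_continuous X d h" "\<And>x. x \<in> X \<Longrightarrow> h x \<le> a" by auto
    have "(INF x\<in>Q. h x) \<le> (INF x\<in>Q'. h x) + ennreal t"
    proof (cases "a \<le> ennreal t")
      case True
      obtain x where x: "x \<in> Q" using smyth_nonempty[OF Q] by blast
      then have "(INF x\<in>Q. h x) \<le> h x" by (rule INF_lower)
      also have "\<dots> \<le> ennreal t" using h(2)[of x] x smyth_subset[OF Q] True by (meson order_trans subsetD)
      finally show ?thesis by (simp add: add_increasing)
    next
      case False
      \<comment> \<open>Moving \<open>t\<close> to the left gives a lower bound free of the point of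
        \<open>Q'\<close>, so the infimum over \<open>Q'\<close> can be taken pointwise.\<close>
      have "(INF x\<in>Q. h x) - ennreal t \<le> (INF x\<in>Q'. h x)"
      proof (rule INF_greatest)
        fix z assume z: "z \<in> Q'"
        then obtain x where x: "x \<in> Q" "d x z \<le> ennreal t" using le False by blast
        have "(INF x\<in>Q. h x) \<le> h x" using x(1) by (rule INF_lower)
        also have "\<dots> \<le> h z + ennreal t"
          using lipschitz1_continuousD[OF h(1) _ _ t x(2)] x(1) z smyth_subset[OF Q] smyth_subset[OF Q']
          by blast
        finally show "(INF x\<in>Q. h x) - ennreal t \<le> h z"
          by (simp add: ennreal_minus_le_iff add.commute)
      qed
      then show ?thesis by (simp add: ennreal_minus_le_iff add.commute)
    qed
    then show "d_R (INF x\<in>Q. h x) (INF x\<in>Q'. h x) \<le> ennreal t" using d_R_le_iff[OF t] by blast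
  qed
qed

end

section \<open>The Smyth powerdomain\<close>

text \<open>Fixing \<open>e\<close> only through its thresholds keeps Lipschitz maps out of all that
  follows.\<close>

locale smyth_distance = yoneda_complete X d
  for X :: "'a set" and d :: "'a \<Rightarrow> 'a \<Rightarrow> ennreal" +
  fixes a :: ennreal and e :: "'a set \<Rightarrow> 'a set \<Rightarrow> ennreal"
  assumes a_pos: "0 < a"
    and e_le_iff: "\<And>Q Q' t. Q \<in> smyth X d \<Longrightarrow> Q' \<in> smyth X d \<Longrightarrow> 0 \<le> t \<Longrightarrow>
      e Q Q' \<le> ennreal t \<longleftrightarrow> a \<le> ennreal t \<or> (\<forall>z\<in>Q'. \<exists>x\<in>Q. d x z \<le> ennreal t)"
begin

abbreviation BQ :: "('a set \<times> real) gorder" where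
  "BQ \<equiv> formal_balls (smyth X d) e"

lemma BQ_le_iff:
  assumes "Q \<in> smyth X d" "Q' \<in> smyth X d"
  shows "(Q, r) \<sqsubseteq>\<^bsub>BQ\<^esub> (Q', s) \<longleftrightarrow>
    s \<le> r \<and> (a \<le> ennreal (r - s) \<or> (\<forall>z\<in>Q'. \<exists>x\<in>Q. d x z \<le> ennreal (r - s)))"
  using e_le_iff[OF assms, of "r - s"] by auto

lemma BQ_leI:
  assumes "Q \<in> smyth X d" "Q' \<in> smyth X d" "s \<le> r" "\<And>z. z \<in> Q' \<Longrightarrow> \<exists>x\<in>Q. d x z \<le> ennreal (r - s)"
  shows "(Q, r) \<sqsubseteq>\<^bsub>BQ\<^esub> (Q', s)"
  unfolding BQ_le_iff[OF assms(1,2)] using assms(3,4) by blast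

lemma BQ_leD:
  assumes "(Q, r) \<sqsubseteq>\<^bsub>BQ\<^esub> (Q', s)" "Q \<in> smyth X d" "Q' \<in> smyth X d"
    and "ennreal (r - s) < a" and "z \<in> Q'"
  shows "\<exists>x\<in>Q. d x z \<le> ennreal (r - s)"
  using assms BQ_le_iff[OF assms(2,3)] by (meson not_le)

text \<open>The upward closures of finite sets of centres \<open>y\<close> whose balls \<open>(y, \<epsilon>)\<close> approximate every
  point of \<open>Q\<close> form a directed family of formal balls with supremum \<open>(Q, 0)\<close>.\<close>

lemma scott_open_imp_Vietoris_neighbourhood:
  assumes W: "scott_open BQ W" and QW: "(Q, 0) \<in> W"
  shows "\<exists>U. openin (d_scott_topology X d) U \<and> Q \<subseteq> U \<and> (\<forall>Q'\<in>smyth X d. Q' \<subseteq> U \<longrightarrow> (Q', 0) \<in> W)"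
proof -
  have Q: "Q \<in> smyth X d" using scott_open_subset[OF W] QW by auto
  define up where "up E = {y \<in> X. \<exists>x\<in>E. d x y = 0}" for E
  define good where "good E \<epsilon> \<longleftrightarrow> finite E \<and> E \<noteq> {} \<and> E \<subseteq> X \<and> 0 < \<epsilon> \<and>
    (\<forall>x\<in>Q. \<exists>y\<in>E. way_below B (y, \<epsilon>) (x, 0))" for E \<epsilon>
  have up_smyth: "up E \<in> smyth X d" if "good E \<epsilon>" for E \<epsilon>
    using that upward_closure_smyth unfolding good_def up_def by blast
  have up_super: "E \<subseteq> up E" if "good E \<epsilon>" for E \<epsilon>
    using that d_refl unfolding good_def up_def by blast
  have ex_good: "\<exists>E \<epsilon>. good E \<epsilon> \<and> \<epsilon> < \<delta> \<and> (\<forall>y\<in>E. (y, \<epsilon>) \<in> V)"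
    if "scott_open B V" "\<And>x. x \<in> Q \<Longrightarrow> (x, 0) \<in> V" "0 < \<delta>" for V \<delta>
    using finite_approximation[OF Q that] unfolding good_def by blast
  define D where "D = {(up E, \<epsilon>) |E \<epsilon>. good E \<epsilon>}"
  have dir: "directed_in BQ D"
  proof (rule directed_inI)
    show "D \<subseteq> carrier BQ" using up_smyth unfolding D_def good_def by fastforce
    show "D \<noteq> {}"
      using ex_good[OF scott_open_carrier, of 1] smyth_subset[OF Q] unfolding D_def by auto
    fix p q assume "p \<in> D" "q \<in> D"
    then obtain E r F s where pq: "p = (up E, r)" "q = (up F, s)" and E: "good E r" and F: "good F s"
      unfolding D_def by blast
    \<comment> \<open>An open set of balls containing \<open>(x, 0)\<close> for all
      \<open>x \<in> Q\<close>. Choosing the next finite set \<open>G\<close> with its balls in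
      \<open>A E r \<inter> A F s\<close> places \<open>(up G, \<epsilon>)\<close> above both given
      balls.\<close>
    define A where "A E r = \<Union>((\<lambda>y. {p \<in> carrier B. way_below B (y, r) p}) ` E)" for E and r :: real
    have A_open: "scott_open B (A E r)" if "good E r" for E r
      unfolding A_def using that B.scott_open_way_above unfolding good_def
      by (intro scott_open_Union) auto
    have A_Q: "(x, 0) \<in> A E r" if "good E r" "x \<in> Q" for E r x
      using that smyth_subset[OF Q] unfolding good_def A_def by auto
    have "\<exists>G \<epsilon>. good G \<epsilon> \<and> \<epsilon> < min r s \<and> (\<forall>y\<in>G. (y, \<epsilon>) \<in> A E r \<inter> A F s)"
      using A_open A_Q E F by (intro ex_good scott_open_Int) (auto simp: good_def)
    then obtain G \<epsilon> where G: "good G \<epsilon>" "\<epsilon> < min r s"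
        "\<And>y. y \<in> G \<Longrightarrow> (y, \<epsilon>) \<in> A E r" "\<And>y. y \<in> G \<Longrightarrow> (y, \<epsilon>) \<in> A F s"
      by blast
    have below: "(up E, r) \<sqsubseteq>\<^bsub>BQ\<^esub> (up G, \<epsilon>)"
      if E: "good E r" "\<epsilon> < r" "\<And>y. y \<in> G \<Longrightarrow> (y, \<epsilon>) \<in> A E r" for E r
    proof (rule BQ_leI[OF up_smyth[OF E(1)] up_smyth[OF G(1)]])
      fix z assume "z \<in> up G"
      then obtain y where y: "y \<in> G" "d y z = 0" "z \<in> X" unfolding up_def by blast
      then obtain x where x: "x \<in> E" "way_below B (x, r) (y, \<epsilon>)" "(y, \<epsilon>) \<in> carrier B"
        using E(3) unfolding A_def by blast
      then have "d x y \<le> ennreal (r - \<epsilon>)" using B.way_below_le[OF x(2,3)] by simp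
      then have "d x z \<le> ennreal (r - \<epsilon>)"
        using d_zero_le_trans[of x y] x y E(1) G(1) unfolding good_def by blast
      then show "\<exists>x\<in>up E. d x z \<le> ennreal (r - \<epsilon>)" using up_super[OF E(1)] x(1) by blast
    qed (use E in simp)
    have "(up G, \<epsilon>) \<in> D" using G(1) unfolding D_def by blast
    then show "\<exists>w\<in>D. p \<sqsubseteq>\<^bsub>BQ\<^esub> w \<and> q \<sqsubseteq>\<^bsub>BQ\<^esub> w"
      using below[OF E] below[OF F] G(2-4) pq by (intro bexI[of _ "(up G, \<epsilon>)"]) auto
  qed
  have "is_sup BQ D (Q, 0)"
  proof (rule is_supI)
    fix p assume "p \<in> D"
    then obtain E r where p: "p = (up E, r)" and E: "good E r" unfolding D_def by blast
    have "(up E, r) \<sqsubseteq>\<^bsub>BQ\<^esub> (Q, 0)"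
    proof (rule BQ_leI[OF up_smyth[OF E] Q])
      fix z assume z: "z \<in> Q"
      then obtain y where y: "y \<in> E" "way_below B (y, r) (z, 0)" using E unfolding good_def by blast
      then have "d y z \<le> ennreal (r - 0)"
        using B.way_below_le[OF y(2)] z smyth_subset[OF Q] by auto
      then show "\<exists>x\<in>up E. d x z \<le> ennreal (r - 0)" using y up_super[OF E] by blast
    qed (use E in \<open>simp add: good_def\<close>)
    then show "p \<sqsubseteq>\<^bsub>BQ\<^esub> (Q, 0)" using p by simp
  next
    fix p assume p: "p \<in> carrier BQ" "\<And>q. q \<in> D \<Longrightarrow> q \<in> carrier BQ \<Longrightarrow> q \<sqsubseteq>\<^bsub>BQ\<^esub> p"
    obtain Q' s where eq: "p = (Q', s)" by (cases p)
    have Q': "Q' \<in> smyth X d" and "0 \<le> s" using p eq by auto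
    have ub: "(up E, \<epsilon>) \<sqsubseteq>\<^bsub>BQ\<^esub> (Q', s)" if "good E \<epsilon>" for E \<epsilon>
      using p(2)[of "(up E, \<epsilon>)"] directed_in_subset[OF dir] that eq unfolding D_def by blast
    \<comment> \<open>Good sets exist with arbitrarily small radius, so an upper bound of
      \<open>D\<close> has radius 0.\<close>
    have "\<not> 0 < s"
    proof
      assume "0 < s"
      then obtain E \<epsilon> where "good E \<epsilon>" "\<epsilon> < s"
        using ex_good[OF scott_open_carrier, of s] smyth_subset[OF Q] by auto
      then show False using ub[of E \<epsilon>] BQ_le_iff[OF up_smyth Q'] by fastforce
    qed
    then have s: "s = 0" using \<open>0 \<le> s\<close> by simp
    have "Q' \<subseteq> Q"
    proof (rule subsetI, rule ccontr)
      fix z assume z: "z \<in> Q'" "z \<notin> Q"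
      then have zX: "z \<in> X" using smyth_subset[OF Q'] by blast
      \<comment> \<open>By saturation, no \<open>(x, 0)\<close> with \<open>x \<in> Q\<close> lies
        below \<open>(z, 0)\<close>; a good \<open>E\<close> can inherit this. Taking its radius
        below \<delta> keeps the cap \<open>a\<close> out of the comparison with
        \<open>Q'\<close>.\<close>
      obtain \<delta> where \<delta>: "0 < \<delta>" "ennreal \<delta> < a" using ennreal_real_between[of 0 a] a_pos by auto
      have "\<exists>E \<epsilon>. good E \<epsilon> \<and> \<epsilon> < \<delta> \<and> (\<forall>y\<in>E. (y, \<epsilon>) \<in> {p \<in> carrier B. \<not> p \<sqsubseteq>\<^bsub>B\<^esub> (z, 0)})"
      proof (rule ex_good[OF scott_open_not_le[OF zX order_refl] _ \<delta>(1)])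
        fix x assume x: "x \<in> Q"
        then show "(x, 0) \<in> {p \<in> carrier B. \<not> p \<sqsubseteq>\<^bsub>B\<^esub> (z, 0)}"
          using smyth_saturated[OF Q x zX] z(2) smyth_subset[OF Q] by auto
      qed
      then obtain E \<epsilon> where E: "good E \<epsilon>" "\<epsilon> < \<delta>" "\<And>y. y \<in> E \<Longrightarrow> \<not> (y, \<epsilon>) \<sqsubseteq>\<^bsub>B\<^esub> (z, 0)"
        by blast
      have "ennreal (\<epsilon> - s) < a" using E(2) \<delta>(2) s by (metis diff_zero ennreal_leI le_less_trans less_imp_le)
      then obtain y where y: "y \<in> up E" "d y z \<le> ennreal (\<epsilon> - s)"
        using BQ_leD[OF ub[OF E(1)] up_smyth[OF E(1)] Q' _ z(1)] by blast
      then obtain x where x: "x \<in> E" "d x y = 0" "y \<in> X" unfolding up_def by blast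
      then have "d x z \<le> ennreal \<epsilon>"
        using zero_d_le_trans[of x y z \<epsilon>] y s zX E(1) unfolding good_def by auto
      then show False using E(3)[OF x(1)] E(1) unfolding good_def by simp
    qed
    then have "(Q, 0) \<sqsubseteq>\<^bsub>BQ\<^esub> (Q', 0)"
      using d_refl smyth_subset[OF Q'] by (intro BQ_leI[OF Q Q']) (auto intro!: bexI)
    then show "(Q, 0) \<sqsubseteq>\<^bsub>BQ\<^esub> p" using eq s by simp
  qed (use Q in simp)
  then obtain p where "p \<in> D" "p \<in> W" using scott_open_sup[OF W dir _ QW] by blast
  then obtain E r where E: "good E r" "(up E, r) \<in> W" unfolding D_def by blast
  let ?U = "\<Union>y\<in>E. {x \<in> X. (x, 0) \<in> {p \<in> carrier B. way_below B (y, r) p}}"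
  have "openin (d_scott_topology X d) ?U"
  proof (rule openin_Union, elim imageE)
    fix S y assume "y \<in> E" and S: "S = {x \<in> X. (x, 0) \<in> {p \<in> carrier B. way_below B (y, r) p}}"
    then have "(y, r) \<in> carrier B" using E(1) unfolding good_def by auto
    then show "openin (d_scott_topology X d) S"
      unfolding S by (intro openin_slice B.scott_open_way_above) simp_all
  qed
  moreover have "Q \<subseteq> ?U" using E(1) smyth_subset[OF Q] unfolding good_def by fastforce
  moreover have "(Q', 0) \<in> W" if Q': "Q' \<in> smyth X d" "Q' \<subseteq> ?U" for Q'
  proof -
    have "(up E, r) \<sqsubseteq>\<^bsub>BQ\<^esub> (Q', 0)"
    proof (rule BQ_leI[OF up_smyth[OF E(1)] Q'(1)])
      fix z assume "z \<in> Q'"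
      then obtain y where y: "y \<in> E" "way_below B (y, r) (z, 0)" "(z, 0) \<in> carrier B" using Q'(2) by blast
      then have "d y z \<le> ennreal (r - 0)" using B.way_below_le[OF y(2,3)] by simp
      then show "\<exists>x\<in>up E. d x z \<le> ennreal (r - 0)" using y(1) up_super[OF E(1)] by blast
    qed (use E(1) in \<open>simp add: good_def\<close>)
    then show ?thesis using scott_open_upward[OF W E(2)] Q'(1) by simp
  qed
  ultimately show ?thesis by blast
qed

text \<open>Only the part of \<open>D\<close> with radii close to the infimum matters: there the cap \<open>a\<close> is inactive.\<close>

lemma directed_limit:
  assumes D: "directed_in BQ D" and \<rho>: "\<rho> = Inf (snd ` D)"
  shows "\<exists>Q\<in>smyth X d. (\<forall>p\<in>D. p \<sqsubseteq>\<^bsub>BQ\<^esub> (Q, \<rho>)) \<and>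
    (\<forall>V. scott_open B V \<longrightarrow> (\<forall>x\<in>Q. (x, \<rho>) \<in> V) \<longrightarrow> (\<exists>Q' r. (Q', r) \<in> D \<and> (\<forall>y\<in>Q'. (y, r) \<in> V)))"
proof -
  obtain b where b: "0 < b" "ennreal b < a" using ennreal_real_between[of 0 a] a_pos by auto
  have car: "Q \<in> smyth X d" "0 \<le> r" if "(Q, r) \<in> D" for Q r
    using directed_in_subset[OF D] that by auto
  have ne: "snd ` D \<noteq> {}" using directed_in_nonempty[OF D] by auto
  have lower: "\<rho> \<le> r" if "(Q, r) \<in> D" for Q r
    unfolding \<rho> using car that by (intro cInf_lower bdd_belowI[of _ 0]) force+
  have "0 \<le> \<rho>" unfolding \<rho> using car by (intro cInf_greatest ne) auto
  define D' where "D' = {(Q, r) \<in> D. r < \<rho> + b}"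
  have D': "(Q, r) \<in> D' \<longleftrightarrow> (Q, r) \<in> D \<and> r < \<rho> + b" for Q r unfolding D'_def by simp
  obtain Q0 r0 where 0: "(Q0, r0) \<in> D'"
    using cInf_lessD[OF ne, of "\<rho> + b"] b(1) unfolding D' \<rho> by force
  \<comment> \<open>Radii in \<open>D'\<close> exceed \<rho> by less than \<open>b < a\<close>, so
    inequalities starting in \<open>D'\<close> become pointwise inequalities between balls of
    \<open>X\<close>.\<close>
  have D'_le: "(Q2, r2) \<in> D' \<and> r2 \<le> r1 \<and> (\<forall>z\<in>Q2. \<exists>x\<in>Q1. (x, r1) \<sqsubseteq>\<^bsub>B\<^esub> (z, r2))"
    if 12: "(Q1, r1) \<in> D'" "(Q2, r2) \<in> D" "(Q1, r1) \<sqsubseteq>\<^bsub>BQ\<^esub> (Q2, r2)" for Q1 r1 Q2 r2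
  proof -
    have r: "r2 \<le> r1" using 12(3) by simp
    have "r1 - r2 < b" using 12(1) lower[OF 12(2)] unfolding D' by simp
    then have small: "ennreal (r1 - r2) < a" using b(2) by (meson ennreal_leI le_less_trans less_imp_le)
    have Q12: "Q1 \<in> smyth X d" "Q2 \<in> smyth X d" using 12 car unfolding D' by blast+
    have "\<exists>x\<in>Q1. (x, r1) \<sqsubseteq>\<^bsub>B\<^esub> (z, r2)" if "z \<in> Q2" for z
      using BQ_leD[OF 12(3) Q12 small that] r by simp
    then show ?thesis using 12 r unfolding D' by auto
  qed
  have D'_directed: "\<exists>Q3 r3. (Q3, r3) \<in> D' \<and> r3 \<le> r1 \<and> r3 \<le> r2 \<and>
      (\<forall>z\<in>Q3. (\<exists>x\<in>Q1. (x, r1) \<sqsubseteq>\<^bsub>B\<^esub> (z, r3)) \<and> (\<exists>x\<in>Q2. (x, r2) \<sqsubseteq>\<^bsub>B\<^esub> (z, r3)))"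
    if 12: "(Q1, r1) \<in> D'" "(Q2, r2) \<in> D'" for Q1 r1 Q2 r2
  proof -
    obtain Q3 r3 where 3: "(Q3, r3) \<in> D" "(Q1, r1) \<sqsubseteq>\<^bsub>BQ\<^esub> (Q3, r3)" "(Q2, r2) \<sqsubseteq>\<^bsub>BQ\<^esub> (Q3, r3)"
      using directed_inD[OF D, of "(Q1, r1)" "(Q2, r2)"] 12 unfolding D' by auto
    show ?thesis using D'_le[OF 12(1) 3(1,2)] D'_le[OF 12(2) 3(1,3)] by blast
  qed
  \<comment> \<open>The discarded balls have radius at least \<open>\<rho> + b\<close>, hence larger
    than \<open>r0\<close>, so \<open>D'\<close> has the same infimum of radii as
    \<open>D\<close>.\<close>
  have greatest: "t \<le> \<rho>" if t: "\<And>Q r. (Q, r) \<in> D' \<Longrightarrow> t \<le> r" for t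
    unfolding \<rho>
  proof (rule cInf_greatest[OF ne])
    fix r assume "r \<in> snd ` D"
    then obtain Q where "(Q, r) \<in> D" by auto
    then show "t \<le> r" using t[of Q r] t[OF 0] 0 unfolding D' by linarith
  qed
  define Q where "Q = {x \<in> X. \<forall>Q' r. (Q', r) \<in> D' \<longrightarrow> (\<exists>y\<in>Q'. (y, r) \<sqsubseteq>\<^bsub>B\<^esub> (x, \<rho>))}"
  have ball_compact: "compactin (scott_topology B) ((\<lambda>x. (x, r)) ` Q')" if "(Q', r) \<in> D'" for Q' r
    using image_compactin[OF smyth_compact continuous_map_ball] car that unfolding D' by blast
  have key: "\<exists>Q' r. (Q', r) \<in> D' \<and> (\<forall>y\<in>Q'. (y, r) \<in> V)"
    if V: "scott_open B V" and QV: "\<And>x. x \<in> Q \<Longrightarrow> (x, \<rho>) \<in> V" for V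
  proof (rule ccontr)
    assume contra: "\<not> ?thesis"
    \<comment> \<open>\<open>S\<close> consists of the balls of radius below \<rho>. Removing it as
      well as \<open>V\<close> forces the limit ball to have radius at least \<rho>; lying above a
      ball of every member of \<open>D'\<close> forces at most \<rho>.\<close>
    define S where "S = {(x, t). x \<in> X \<and> 0 \<le> t \<and> (t + - \<rho> < 0 \<or> (x, t + - \<rho>) \<in> {})}"
    have S: "scott_open B S"
      unfolding S_def by (rule scott_open_shift) (simp flip: openin_scott_topology)
    define C where "C = carrier B - (V \<union> S)"
    define \<K> where "\<K> = {(\<lambda>x. (x, r)) ` Q' |Q' r. (Q', r) \<in> D'}"
    have "openin (scott_topology B) (V \<union> S)"
      using V S by (intro openin_Un) (simp_all add: openin_scott_topology)
    then have C: "closedin (scott_topology B) C"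
      unfolding C_def using closedin_diff[OF closedin_topspace] by force
    have ne: "\<K> \<noteq> {}" using 0 unfolding \<K>_def by blast
    have compact: "compactin (scott_topology B) K" if "K \<in> \<K>" for K
      using that ball_compact unfolding \<K>_def by auto
    have filtered: "\<exists>K3\<in>\<K>. \<forall>y\<in>K3. (\<exists>x\<in>K1. x \<sqsubseteq>\<^bsub>B\<^esub> y) \<and> (\<exists>x\<in>K2. x \<sqsubseteq>\<^bsub>B\<^esub> y)"
      if K: "K1 \<in> \<K>" "K2 \<in> \<K>" for K1 K2
    proof -
      obtain Q1 r1 Q2 r2 where 12: "(Q1, r1) \<in> D'" "(Q2, r2) \<in> D'"
          "K1 = (\<lambda>x. (x, r1)) ` Q1" "K2 = (\<lambda>x. (x, r2)) ` Q2"
        using K unfolding \<K>_def by blast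
      obtain Q3 r3 where 3: "(Q3, r3) \<in> D'"
          "\<forall>z\<in>Q3. (\<exists>x\<in>Q1. (x, r1) \<sqsubseteq>\<^bsub>B\<^esub> (z, r3)) \<and> (\<exists>x\<in>Q2. (x, r2) \<sqsubseteq>\<^bsub>B\<^esub> (z, r3))"
        using D'_directed[OF 12(1,2)] by blast
      then have "(\<lambda>x. (x, r3)) ` Q3 \<in> \<K>" unfolding \<K>_def by blast
      then show ?thesis
        by (rule bexI[rotated]) (use 3(2) in \<open>simp add: 12(3,4)\<close>)
    qed
    have meets: "C \<inter> K \<noteq> {}" if K: "K \<in> \<K>" for K
    proof -
      obtain Q' r where Q': "(Q', r) \<in> D'" "K = (\<lambda>x. (x, r)) ` Q'" using K unfolding \<K>_def by blast
      then obtain y where y: "y \<in> Q'" "(y, r) \<notin> V" using contra by blast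
      have "(Q', r) \<in> D" using Q'(1) unfolding D' by simp
      then have "y \<in> X" "\<rho> \<le> r" "0 \<le> r" using y(1) car lower smyth_subset by blast+
      then have "(y, r) \<in> C" using y(2) unfolding C_def S_def by simp
      then show ?thesis using y Q' by blast
    qed
    obtain p where p: "p \<in> C" "\<forall>K\<in>\<K>. \<exists>q\<in>K. q \<sqsubseteq>\<^bsub>B\<^esub> p"
      using B.filtered_compact_meets_closed[OF ne compact filtered C meets] by (rule bexE)
    obtain x t where eq: "p = (x, t)" by (cases p)
    have x: "x \<in> X" "\<rho> \<le> t" "(x, t) \<notin> V" using p(1) eq unfolding C_def S_def by auto
    have above: "\<exists>y\<in>Q'. (y, r) \<sqsubseteq>\<^bsub>B\<^esub> (x, t)" if "(Q', r) \<in> D'" for Q' r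
    proof -
      have "(\<lambda>x. (x, r)) ` Q' \<in> \<K>" using that unfolding \<K>_def by blast
      then have "\<exists>q\<in>(\<lambda>x. (x, r)) ` Q'. q \<sqsubseteq>\<^bsub>B\<^esub> (x, t)" using p(2) unfolding eq by blast
      then show ?thesis by blast
    qed
    then have "t \<le> r" if "(Q', r) \<in> D'" for Q' r using that by fastforce
    then have "t \<le> \<rho>" by (rule greatest)
    then have "t = \<rho>" using x(2) by simp
    then have "x \<in> Q" using above x(1) unfolding Q_def by blast
    then show False using QV x(3) \<open>t = \<rho>\<close> by blast
  qed
  \<comment> \<open>Were \<open>Q\<close> empty, \<open>key\<close> for the empty open set would
    yield an empty member of the family.\<close>
  have "Q \<noteq> {}"
  proof
    assume "Q = {}"
    moreover have "scott_open B {}" by (simp flip: openin_scott_topology)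
    ultimately obtain Q' r where "(Q', r) \<in> D'" "\<forall>y\<in>Q'. (y, r) \<in> {}" using key[of "{}"] by blast
    then show False using smyth_nonempty[of Q' X d] car unfolding D' by blast
  qed
  moreover have "compactin (d_scott_topology X d) Q"
    unfolding compactin_def
  proof (intro conjI allI impI; (elim conjE)?)
    show "Q \<subseteq> topspace (d_scott_topology X d)" unfolding Q_def by auto
    fix \<U> assume U: "\<forall>U\<in>\<U>. openin (d_scott_topology X d) U" "Q \<subseteq> \<Union>\<U>"
    have "\<forall>U\<in>\<U>. \<exists>V. scott_open B V \<and> U = {x \<in> X. (x, 0) \<in> V}"
      using U(1) unfolding openin_d_scott_topology .
    from bchoice[OF this] obtain f where
      f: "\<And>U. U \<in> \<U> \<Longrightarrow> scott_open B (f U)" "\<And>U. U \<in> \<U> \<Longrightarrow> U = {x \<in> X. (x, 0) \<in> f U}"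
      by blast
    \<comment> \<open>\<open>U\<close> is the slice of \<open>f U\<close> at radius 0, whereas
      \<open>key\<close> concerns radius \<rho>; after translation the slice at \<rho> is
      \<open>U\<close>. The finite subcover is extracted for a compact set of balls from
      \<open>D'\<close> and passes to \<open>Q\<close> because every \<open>S U\<close> is upwards
      closed.\<close>
    define S where "S U = {(x, t). x \<in> X \<and> 0 \<le> t \<and> (t + - \<rho> < 0 \<or> (x, t + - \<rho>) \<in> f U)}" for U
    have S: "scott_open B (S U)" if "U \<in> \<U>" for U
      unfolding S_def by (rule scott_open_shift[OF f(1)[OF that]])
    have S_iff: "(x, \<rho>) \<in> S U \<longleftrightarrow> x \<in> U" if "U \<in> \<U>" for x U
      using f(2)[OF that] \<open>0 \<le> \<rho>\<close> unfolding S_def by auto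
    have "\<exists>Q' r. (Q', r) \<in> D' \<and> (\<forall>y\<in>Q'. (y, r) \<in> \<Union>(S ` \<U>))"
    proof (rule key)
      show "scott_open B (\<Union>(S ` \<U>))" using S by (intro scott_open_Union) auto
      show "(x, \<rho>) \<in> \<Union>(S ` \<U>)" if "x \<in> Q" for x using that U(2) S_iff by blast
    qed
    then obtain Q' r where Q': "(Q', r) \<in> D'" "(\<lambda>x. (x, r)) ` Q' \<subseteq> \<Union>(S ` \<U>)" by blast
    have "openin (scott_topology B) W" if "W \<in> S ` \<U>" for W
      using that S by (auto simp: openin_scott_topology)
    then obtain \<F> where F: "finite \<F>" "\<F> \<subseteq> S ` \<U>" "(\<lambda>x. (x, r)) ` Q' \<subseteq> \<Union>\<F>"
      using compactinD[OF ball_compact[OF Q'(1)] _ Q'(2)] by blast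
    then obtain \<G> where G: "\<G> \<subseteq> \<U>" "finite \<G>" "\<F> = S ` \<G>"
      using finite_subset_image[OF F(1,2)] by blast
    have "x \<in> \<Union>\<G>" if x: "x \<in> Q" for x
    proof -
      obtain y where y: "y \<in> Q'" "(y, r) \<sqsubseteq>\<^bsub>B\<^esub> (x, \<rho>)" using x Q'(1) unfolding Q_def by blast
      then obtain U where "U \<in> \<G>" "(y, r) \<in> S U" using F(3) G(3) by blast
      moreover have "(x, \<rho>) \<in> carrier B" using x \<open>0 \<le> \<rho>\<close> unfolding Q_def by simp
      ultimately have "(x, \<rho>) \<in> S U" using scott_open_upward[OF S] y(2) G(1) by blast
      then show ?thesis using S_iff \<open>U \<in> \<G>\<close> G(1) by blast
    qed
    then show "\<exists>\<F>. finite \<F> \<and> \<F> \<subseteq> \<U> \<and> Q \<subseteq> \<Union>\<F>" using G(1,2) by blast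
  qed
  moreover have "z \<in> Q" if xz: "x \<in> Q" "z \<in> X" "d x z = 0" for x z
  proof -
    have x: "x \<in> X" "(x, \<rho>) \<sqsubseteq>\<^bsub>B\<^esub> (z, \<rho>)" using xz unfolding Q_def by auto
    have "\<exists>y\<in>Q'. (y, r) \<sqsubseteq>\<^bsub>B\<^esub> (z, \<rho>)" if Q': "(Q', r) \<in> D'" for Q' r
    proof -
      obtain y where y: "y \<in> Q'" "(y, r) \<sqsubseteq>\<^bsub>B\<^esub> (x, \<rho>)" using xz(1) Q' unfolding Q_def by blast
      have "y \<in> X" "0 \<le> r" using y(1) Q' car smyth_subset unfolding D' by blast+
      then have "(y, r) \<sqsubseteq>\<^bsub>B\<^esub> (z, \<rho>)"
        using B.le_trans[OF y(2) x(2)] x(1) xz(2) \<open>0 \<le> \<rho>\<close> by simp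
      then show ?thesis using y(1) by blast
    qed
    then show ?thesis using xz(2) unfolding Q_def by blast
  qed
  ultimately have Q: "Q \<in> smyth X d" unfolding smyth_def by blast
  moreover have "p \<sqsubseteq>\<^bsub>BQ\<^esub> (Q, \<rho>)" if p: "p \<in> D" for p
  proof -
    obtain Q' r where eq: "p = (Q', r)" by (cases p)
    have Q': "Q' \<in> smyth X d" "\<rho> \<le> r" using car lower p eq by auto
    show ?thesis
    proof (cases "a \<le> ennreal (r - \<rho>)")
      case True
      then show ?thesis using BQ_le_iff[OF Q'(1) Q] Q'(2) eq by blast
    next
      case False
      \<comment> \<open>The ball \<open>p\<close> may lie outside \<open>D'\<close>, but a common
        upper bound with \<open>(Q0, r0)\<close> lies inside, and the triangle inequality passes
        through it.\<close>
      obtain Q1 r1 where 1: "(Q1, r1) \<in> D" "(Q', r) \<sqsubseteq>\<^bsub>BQ\<^esub> (Q1, r1)" "(Q0, r0) \<sqsubseteq>\<^bsub>BQ\<^esub> (Q1, r1)"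
        using directed_inD[OF D, of "(Q', r)" "(Q0, r0)"] p 0 eq unfolding D' by auto
      have 2: "(Q1, r1) \<in> D'" "Q1 \<in> smyth X d" using D'_le[OF 0 1(1,3)] car[OF 1(1)] by blast+
      have r1: "\<rho> \<le> r1" "r1 \<le> r" using lower[OF 1(1)] 1(2) by auto
      have small: "ennreal (r - r1) < a"
        using False r1 by (meson diff_left_mono ennreal_leI le_less_trans not_le)
      have "\<exists>x\<in>Q'. d x z \<le> ennreal (r - \<rho>)" if z: "z \<in> Q" for z
      proof -
        obtain y where y: "y \<in> Q1" "(y, r1) \<sqsubseteq>\<^bsub>B\<^esub> (z, \<rho>)" using z 2(1) unfolding Q_def by blast
        obtain x where x: "x \<in> Q'" "d x y \<le> ennreal (r - r1)"
          using BQ_leD[OF 1(2) Q'(1) 2(2) small y(1)] by blast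
        have "x \<in> X" "y \<in> X" "z \<in> X" using x y z smyth_subset Q'(1) 2(2) Q by blast+
        then have "d x z \<le> d x y + d y z" by (rule d_triangle)
        also have "\<dots> \<le> ennreal (r - r1) + ennreal (r1 - \<rho>)" using x(2) y(2) by (intro add_mono) auto
        also have "\<dots> = ennreal (r - \<rho>)" using r1 by (simp flip: ennreal_plus)
        finally show ?thesis using x(1) by blast
      qed
      then show ?thesis unfolding eq using Q'(2) by (intro BQ_leI[OF Q'(1) Q])
    qed
  qed
  moreover have "\<exists>Q' r. (Q', r) \<in> D \<and> (\<forall>y\<in>Q'. (y, r) \<in> V)"
    if "scott_open B V" "\<forall>x\<in>Q. (x, \<rho>) \<in> V" for V
    using key[of V] that unfolding D' by blast
  ultimately show ?thesis by blast
qed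

section \<open>Upper Vietoris open sets are open for the Scott topology of the distance\<close>

text \<open>Intersecting with this set leaves the slice at radius 0 unchanged, as
  \<open>0 < a\<close>, and guarantees that the cap is inactive in every comparison starting from a
  remaining ball.\<close>

lemma scott_open_radius_less: "scott_open B {p \<in> carrier B. ennreal (snd p) < a}"
proof (rule scott_openI)
  fix p q assume "p \<in> {p \<in> carrier B. ennreal (snd p) < a}" "q \<in> carrier B" "p \<sqsubseteq>\<^bsub>B\<^esub> q"
  then show "q \<in> {p \<in> carrier B. ennreal (snd p) < a}"
    by (cases p; cases q) (auto intro: le_less_trans[OF ennreal_leI])
next
  fix D p assume D: "directed_in B D" "is_sup B D p" and p: "p \<in> {p \<in> carrier B. ennreal (snd p) < a}"
  obtain x r where eq: "p = (x, r)" by (cases p)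
  obtain b where b: "r < b" "ennreal b < a" using ennreal_real_between[of r a] p eq by auto
  then obtain y s where "(y, s) \<in> D" "s < b" using sup_radius_approx[OF D(1) D(2)[unfolded eq]] by blast
  moreover then have "ennreal s < a" using b(2) by (meson ennreal_leI le_less_trans less_imp_le)
  ultimately show "\<exists>q\<in>D. q \<in> {p \<in> carrier B. ennreal (snd p) < a}"
    using directed_in_subset[OF D(1)] by (intro bexI[of _ "(y, s)"]) auto
qed auto

text \<open>The set \<open>W\<close> of balls \<open>(Q, r)\<close> all of whose point balls
  \<open>(x, r)\<close> lie in \<open>V\<close> is Scott-open: a given supremum
  \<open>(Q, r)\<close> in \<open>W\<close> lies below the constructed limit
  \<open>(Q1, \<rho>)\<close>, which forces \<open>r = \<rho>\<close> and
  \<open>Q1 \<subseteq> Q\<close>, so the limit inherits \<open>V\<close> and some member of the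
  family already has it.\<close>

lemma openin_smyth_subsets:
  assumes "openin (d_scott_topology X d) U"
  shows "openin (d_scott_topology (smyth X d) e) {Q \<in> smyth X d. Q \<subseteq> U}"
proof -
  obtain V0 where V0: "scott_open B V0" "U = {x \<in> X. (x, 0) \<in> V0}"
    using assms unfolding openin_d_scott_topology by blast
  define V where "V = V0 \<inter> {p \<in> carrier B. ennreal (snd p) < a}"
  have V: "scott_open B V" unfolding V_def by (rule scott_open_Int[OF V0(1) scott_open_radius_less])
  have U: "U = {x \<in> X. (x, 0) \<in> V}" using V0(2) a_pos unfolding V_def by auto
  define W where "W = {(Q, r). Q \<in> smyth X d \<and> 0 \<le> r \<and> (\<forall>x\<in>Q. (x, r) \<in> V)}"
  have "scott_open BQ W"
  proof (rule scott_openI)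
    show "W \<subseteq> carrier BQ" unfolding W_def by auto
    fix p q assume p: "p \<in> W" and q: "q \<in> carrier BQ" and pq: "p \<sqsubseteq>\<^bsub>BQ\<^esub> q"
    obtain Q r Q' s where eq: "p = (Q, r)" "q = (Q', s)" by (cases p; cases q)
    have Q: "Q \<in> smyth X d" "Q' \<in> smyth X d" "0 \<le> s" and QV: "\<And>x. x \<in> Q \<Longrightarrow> (x, r) \<in> V"
      using p q eq unfolding W_def by auto
    have sr: "s \<le> r" using pq eq by simp
    obtain x where "x \<in> Q" using smyth_nonempty[OF Q(1)] by blast
    then have "ennreal r < a" using QV unfolding V_def by auto
    moreover have "ennreal (r - s) \<le> ennreal r" using Q(3) by (intro ennreal_leI) simp
    ultimately have small: "ennreal (r - s) < a" by (rule le_less_trans[rotated])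
    have "(z, s) \<in> V" if z: "z \<in> Q'" for z
    proof -
      obtain x where x: "x \<in> Q" "d x z \<le> ennreal (r - s)"
        using BQ_leD[OF pq[unfolded eq] Q(1,2) small z] by blast
      then show ?thesis
        using scott_open_upward[OF V QV[OF x(1)], of "(z, s)"] sr Q(3) z smyth_subset[OF Q(2)] by auto
    qed
    then show "q \<in> W" using Q eq unfolding W_def by simp
  next
    fix D p assume D: "directed_in BQ D" and sup: "is_sup BQ D p" and p: "p \<in> W"
    obtain Q r where eq: "p = (Q, r)" by (cases p)
    have Q: "Q \<in> smyth X d" "0 \<le> r" and QV: "\<And>x. x \<in> Q \<Longrightarrow> (x, r) \<in> V"
      using p eq unfolding W_def by auto
    define \<rho> where "\<rho> = Inf (snd ` D)"
    obtain Q1 where Q1: "Q1 \<in> smyth X d" "\<forall>p\<in>D. p \<sqsubseteq>\<^bsub>BQ\<^esub> (Q1, \<rho>)"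
        "\<forall>V. scott_open B V \<longrightarrow> (\<forall>x\<in>Q1. (x, \<rho>) \<in> V) \<longrightarrow> (\<exists>Q' r. (Q', r) \<in> D \<and> (\<forall>y\<in>Q'. (y, r) \<in> V))"
      using directed_limit[OF D \<rho>_def] by (elim bexE conjE)
    have "r \<le> s" if s: "s \<in> snd ` D" for s
    proof -
      obtain Q' where Q': "(Q', s) \<in> D" using s by auto
      then have "(Q', s) \<sqsubseteq>\<^bsub>BQ\<^esub> (Q, r)"
        using is_sup_upper[OF sup] directed_in_subset[OF D] eq by blast
      then show ?thesis by simp
    qed
    then have "r \<le> \<rho>" unfolding \<rho>_def using directed_in_nonempty[OF D] by (intro cInf_greatest) auto
    then have "(Q1, \<rho>) \<in> carrier BQ" using Q1(1) Q(2) by simp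
    then have le: "(Q, r) \<sqsubseteq>\<^bsub>BQ\<^esub> (Q1, \<rho>)" using is_sup_least[OF sup] Q1(2) eq by blast
    then have r: "r = \<rho>" using \<open>r \<le> \<rho>\<close> by simp
    have "(z, \<rho>) \<in> V" if z: "z \<in> Q1" for z
    proof -
      have "ennreal (r - \<rho>) < a" using r a_pos by simp
      then obtain x where x: "x \<in> Q" "d x z \<le> ennreal (r - \<rho>)"
        using BQ_leD[OF le Q(1) Q1(1) _ z] by blast
      then have "z \<in> Q" using smyth_saturated[OF Q(1) x(1)] z smyth_subset[OF Q1(1)] r by auto
      then show ?thesis using QV r by blast
    qed
    then obtain Q' s where "(Q', s) \<in> D" "\<forall>y\<in>Q'. (y, s) \<in> V" using Q1(3) V by blast
    then show "\<exists>q\<in>D. q \<in> W"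
      using directed_in_subset[OF D] unfolding W_def by (intro bexI[of _ "(Q', s)"]) auto
  qed
  moreover have "{Q \<in> smyth X d. Q \<subseteq> U} = {Q \<in> smyth X d. (Q, 0) \<in> W}"
    using smyth_subset[of _ X d] unfolding W_def U by auto
  ultimately show ?thesis unfolding openin_d_scott_topology by blast
qed

theorem d_scott_topology_smyth: "d_scott_topology (smyth X d) e = upper_Vietoris_topology X d"
  unfolding topology_eq
proof (intro allI iffI)
  fix \<W> assume "openin (d_scott_topology (smyth X d) e) \<W>"
  then obtain W where W: "scott_open BQ W" "\<W> = {Q \<in> smyth X d. (Q, 0) \<in> W}"
    unfolding openin_d_scott_topology by blast
  show "openin (upper_Vietoris_topology X d) \<W>"
  proof (subst openin_subopen, rule ballI)
    fix Q assume Q: "Q \<in> \<W>"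
    then obtain U where U: "openin (d_scott_topology X d) U" "Q \<subseteq> U"
        "\<forall>Q'\<in>smyth X d. Q' \<subseteq> U \<longrightarrow> (Q', 0) \<in> W"
      using scott_open_imp_Vietoris_neighbourhood[OF W(1)] W(2) by blast
    have "openin (upper_Vietoris_topology X d) {Q \<in> smyth X d. Q \<subseteq> U}"
      unfolding upper_Vietoris_topology_def using U(1) by (intro topology_generated_by_Basis) blast
    then show "\<exists>T. openin (upper_Vietoris_topology X d) T \<and> Q \<in> T \<and> T \<subseteq> \<W>"
      using Q U W(2) by (intro exI[of _ "{Q \<in> smyth X d. Q \<subseteq> U}"]) auto
  qed
next
  fix \<W> assume "openin (upper_Vietoris_topology X d) \<W>"
  then show "openin (d_scott_topology (smyth X d) e) \<W>"
    unfolding upper_Vietoris_topology_def openin_topology_generated_by_iff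
    by (rule generate_topology_on_coarsest[OF istopology_openin, rotated])
      (use openin_smyth_subsets in blast)
qed

end

theorem theorem13p29:
  fixes X :: "'a set" and d :: "'a \<Rightarrow> 'a \<Rightarrow> ennreal"
  assumes "quasi_metric_space X d"
    and "continuous_Yoneda_complete X d"
  shows "d_scott_topology (smyth X d) (d_Q X d) = upper_Vietoris_topology X d \<and>
         (\<forall>a::real. a > 0 \<longrightarrow>
            d_scott_topology (smyth X d) (d_Q_bounded a X d) = upper_Vietoris_topology X d)"
proof -
  interpret yoneda_complete X d using assms by unfold_locales
  have main: "d_scott_topology (smyth X d) (truncated_d_Q a) = upper_Vietoris_topology X d"
    if "0 < a" for a
  proof -
    interpret smyth_distance X d a "truncated_d_Q a"
      using that truncated_d_Q_le_iff by unfold_locales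
    show ?thesis by (rule d_scott_topology_smyth)
  qed
  have "d_Q X d = truncated_d_Q \<infinity>"
    by (intro ext) (simp add: d_Q_def truncated_d_Q_def)
  moreover have "d_Q_bounded a X d = truncated_d_Q (ennreal a)" for a
    by (intro ext) (simp add: d_Q_bounded_def truncated_d_Q_def)
  ultimately show ?thesis using main by simp
qed

end
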